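(* If $X=Y\cup Z$, $W=Y\cap Z$ is a gated decomposition of a metric space $X$, then the inclusions $j_Y:W\to Y$, $j_Z:W\to Z$, $i_Y:Y\to X$, $i_Z:Z\to X$ induce a short exact sequence (in each degree) $$0\to\mathrm{MH}_*(W)\xrightarrow{\langle (j_Y)_*,\,-(j_Z)_*\rangle}\mathrm{MH}_*(Y)\oplus\mathrm{MH}_*(Z)\xrightarrow{(i_Y)_*\oplus(i_Z)_*}\mathrm{MH}_*(X)\to0,$$ where the second map is $(u,v)\mapsto (i_Y)_*u+(i_Z)_*v$.
   Context: Metric spaces have a finite, symmetric, non-degenerate distance satisfying the triangle inequality; subspaces carry the restricted distance. A point $z$ is between $x$ and $y$ if $d(x,y)=d(x,z)+d(z,y)$. A $k$-path ($k\ge0$) in $X$ is a sequence $\langle x_0,\dots,x_k\rangle$ of points of $X$ with $x_i\ne x_{i+1}$ for $0\le i<k$. Magnitude complex: $\mathrm{MC}_k(X)$ is the free abelian group on the $k$-paths of $X$, with boundary $\partial_k=\sum_{i=1}^{k-1}(-1)^i\partial_{k,i}$, where $\partial_{k,i}\langle x_0,\dots,x_k\rangle=\langle x_0,\dots,\widehat{x_i},\dots,x_k\rangle$ if $x_i$ is between $x_{i-1}$ and $x_{i+1}$, and $0$ otherwise. $\mathrm{MH}_*(X)$ is its homology. The inclusion of a subspace induces the evident inclusion of magnitude complexes. Gated decomposition: subspaces $Y,Z,W$ of $X$ with $X=Y\cup Z$, $W=Y\cap Z$, such that $W$ is gated with respect to $Z$, i.e. for every $z\in Z$ there is a point $\pi(z)\in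 W$ (the gate of $z$) which is between $z$ and $w$ for every $w\in W$.
   Formalization: Added hypothesis: for all y in Y and z in Z some point of W is between y and z. Without it the claim fails: three points at mutual distance 1, Y={0,1}, Z={1,2}, W={1}, where the map to MH_1(X) is not surjective. *)

theory Defs
  imports "HOL-Analysis.Abstract_Metric_Spaces" "HOL-Algebra.Free_Abelian_Groups"
begin

text \<open>
  A metric space is given by a carrier \<open>X\<close> and a distance \<open>d\<close> with \<open>Metric_space X d\<close>; a subspace
  is a subset of \<open>X\<close> with the same \<open>d\<close>. Only values of \<open>d\<close> on the carrier are ever used.
\<close>

definition metric_between :: "('a \<Rightarrow> 'a \<Rightarrow> real) \<Rightarrow> 'a \<Rightarrow> 'a \<Rightarrow> 'a \<Rightarrow> bool" where
  "metric_between d x z y \<longleftrightarrow> d x y = d x z + d z y"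

definition gated_wrt :: "('a \<Rightarrow> 'a \<Rightarrow> real) \<Rightarrow> 'a set \<Rightarrow> 'a set \<Rightarrow> bool" where
  "gated_wrt d W Z \<longleftrightarrow> (\<forall>z\<in>Z. \<exists>p\<in>W. \<forall>w\<in>W. metric_between d z p w)"

text \<open>
  The definition does not relate distances between \<open>Y\<close> and \<open>Z\<close> to \<open>W\<close>: three points at mutual
  distance 1 with \<open>Y = {a, b}\<close>, \<open>Z = {b, c}\<close> are an instance, and there the sequence in degree 1
  is not exact. The theorem therefore also assumes that each point of \<open>Y\<close> and each point of \<open>Z\<close>
  have a point of \<open>W\<close> between them.
\<close>

definition gated_decomposition ::
    "('a \<Rightarrow> 'a \<Rightarrow> real) \<Rightarrow> 'a set \<Rightarrow> 'a set \<Rightarrow> 'a set \<Rightarrow> 'a set \<Rightarrow> bool" where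
  "gated_decomposition d X Y Z W \<longleftrightarrow> X = Y \<union> Z \<and> W = Y \<inter> Z \<and> gated_wrt d W Z"


subsection \<open>The magnitude complex\<close>

definition mag_paths :: "'a set \<Rightarrow> nat \<Rightarrow> 'a list set" where
  "mag_paths X k = {xs. length xs = Suc k \<and> set xs \<subseteq> X \<and> distinct_adj xs}"

definition mag_chain_group :: "'a set \<Rightarrow> nat \<Rightarrow> ('a list \<Rightarrow>\<^sub>0 int) monoid" where
  "mag_chain_group X k = free_Abelian_group (mag_paths X k)"

definition mag_face :: "('a \<Rightarrow> 'a \<Rightarrow> real) \<Rightarrow> nat \<Rightarrow> 'a list \<Rightarrow> ('a list \<Rightarrow>\<^sub>0 int)" where
  "mag_face d i xs =
     (if metric_between d (xs ! (i - 1)) (xs ! i) (xs ! (i + 1))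
      then frag_of (take i xs @ drop (Suc i) xs) else 0)"

text \<open>
  The index \<open>i\<close> runs over \<open>1 \<le> i \<le> k - 1\<close>, so the boundary vanishes for \<open>k = 0\<close> and \<open>k = 1\<close>.
  The formula does not mention the carrier: the chain map induced by the inclusion of a subspace
  is the identity on the underlying formal sums.
\<close>

definition mag_boundary ::
    "('a \<Rightarrow> 'a \<Rightarrow> real) \<Rightarrow> nat \<Rightarrow> ('a list \<Rightarrow>\<^sub>0 int) \<Rightarrow> ('a list \<Rightarrow>\<^sub>0 int)" where
  "mag_boundary d k = frag_extend (\<lambda>xs. \<Sum>i\<in>{1..<k}. frag_cmul ((-1) ^ i) (mag_face d i xs))"


subsection \<open>Magnitude homology\<close>

definition mag_cycle_group ::
    "('a \<Rightarrow> 'a \<Rightarrow> real) \<Rightarrow> 'a set \<Rightarrow> nat \<Rightarrow> ('a list \<Rightarrow>\<^sub>0 int) monoid" where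
  "mag_cycle_group d X k =
     subgroup_generated (mag_chain_group X k)
       {c \<in> carrier (mag_chain_group X k). mag_boundary d k c = 0}"

definition mag_boundaries ::
    "('a \<Rightarrow> 'a \<Rightarrow> real) \<Rightarrow> 'a set \<Rightarrow> nat \<Rightarrow> ('a list \<Rightarrow>\<^sub>0 int) set" where
  "mag_boundaries d X k = mag_boundary d (Suc k) ` carrier (mag_chain_group X (Suc k))"

definition mag_homology ::
    "('a \<Rightarrow> 'a \<Rightarrow> real) \<Rightarrow> 'a set \<Rightarrow> nat \<Rightarrow> ('a list \<Rightarrow>\<^sub>0 int) set monoid" where
  "mag_homology d X k = mag_cycle_group d X k Mod mag_boundaries d X k"

text \<open>
  The homomorphism induced by an inclusion \<open>A \<subseteq> B\<close> sends the class in \<open>A\<close> of a cycle \<open>c\<close> to the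
  class of \<open>c\<close> in \<open>B\<close>. It is written by taking the common class in \<open>B\<close> of all representatives;
  see \<open>mag_incl_coset\<close> below.
\<close>

definition mag_incl ::
    "('a \<Rightarrow> 'a \<Rightarrow> real) \<Rightarrow> nat \<Rightarrow> 'a set \<Rightarrow> 'a set \<Rightarrow> ('a list \<Rightarrow>\<^sub>0 int) set \<Rightarrow> ('a list \<Rightarrow>\<^sub>0 int) set" where
  "mag_incl d k A B C =
     the_elem ((\<lambda>c. mag_boundaries d B k #>\<^bsub>mag_cycle_group d B k\<^esub> c) ` C)"

lemma mag_boundaries_mono:
  assumes "A \<subseteq> B" shows "mag_boundaries d A k \<subseteq> mag_boundaries d B k"
  using assms
  by (auto simp: mag_boundaries_def mag_chain_group_def free_Abelian_group_def mag_paths_def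
      intro!: image_mono Collect_mono)

lemma mag_boundaries_add:
  assumes "x \<in> mag_boundaries d X k" "y \<in> mag_boundaries d X k"
  shows "x + y \<in> mag_boundaries d X k"
proof -
  obtain a b where a: "a \<in> carrier (mag_chain_group X (Suc k))" "x = mag_boundary d (Suc k) a"
    and b: "b \<in> carrier (mag_chain_group X (Suc k))" "y = mag_boundary d (Suc k) b"
    using assms by (auto simp: mag_boundaries_def)
  have "a + b \<in> carrier (mag_chain_group X (Suc k))"
    using a b Poly_Mapping.keys_add[of a b]
    by (auto simp: mag_chain_group_def free_Abelian_group_def)
  moreover have "x + y = mag_boundary d (Suc k) (a + b)"
    using a b by (simp add: mag_boundary_def frag_extend_add)
  ultimately show ?thesis by (simp add: mag_boundaries_def)
qed

lemma mag_boundaries_diff: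
  assumes "x \<in> mag_boundaries d X k" "y \<in> mag_boundaries d X k"
  shows "x - y \<in> mag_boundaries d X k"
proof -
  obtain a b where a: "a \<in> carrier (mag_chain_group X (Suc k))" "x = mag_boundary d (Suc k) a"
    and b: "b \<in> carrier (mag_chain_group X (Suc k))" "y = mag_boundary d (Suc k) b"
    using assms by (auto simp: mag_boundaries_def)
  have "a - b \<in> carrier (mag_chain_group X (Suc k))"
    using a b keys_diff[of a b]
    by (auto simp: mag_chain_group_def free_Abelian_group_def)
  moreover have "x - y = mag_boundary d (Suc k) (a - b)"
    using a b by (simp add: mag_boundary_def frag_extend_diff)
  ultimately show ?thesis by (simp add: mag_boundaries_def)
qed

lemma zero_in_mag_boundaries: "0 \<in> mag_boundaries d X k"
  unfolding mag_boundaries_def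
  by (rule image_eqI[of _ _ 0])
     (simp_all add: mag_boundary_def mag_chain_group_def free_Abelian_group_def)

lemma r_coset_mag_cycle_group:
  "H #>\<^bsub>mag_cycle_group d X k\<^esub> c = (\<lambda>h. h + c) ` H"
  by (auto simp: r_coset_def mag_cycle_group_def subgroup_generated_def mag_chain_group_def
      free_Abelian_group_def)

lemma mag_incl_coset:
  assumes "A \<subseteq> B"
  shows "mag_incl d k A B (mag_boundaries d A k #>\<^bsub>mag_cycle_group d A k\<^esub> c) =
         mag_boundaries d B k #>\<^bsub>mag_cycle_group d B k\<^esub> c"
proof -
  have "(\<lambda>b. b + (h + c)) ` mag_boundaries d B k = (\<lambda>b. b + c) ` mag_boundaries d B k"
    if "h \<in> mag_boundaries d A k" for h
  proof -
    have h: "h \<in> mag_boundaries d B k" using that mag_boundaries_mono[OF assms] by blast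
    show ?thesis
    proof (intro equalityI subsetI)
      fix x assume "x \<in> (\<lambda>b. b + (h + c)) ` mag_boundaries d B k"
      then obtain b where b: "b \<in> mag_boundaries d B k" "x = b + (h + c)" by blast
      then have "x = (b + h) + c" by (simp add: add.assoc)
      then show "x \<in> (\<lambda>b. b + c) ` mag_boundaries d B k"
        using mag_boundaries_add[OF b(1) h] by blast
    next
      fix x assume "x \<in> (\<lambda>b. b + c) ` mag_boundaries d B k"
      then obtain b where b: "b \<in> mag_boundaries d B k" "x = b + c" by blast
      then have "x = (b - h) + (h + c)" by simp
      then show "x \<in> (\<lambda>b. b + (h + c)) ` mag_boundaries d B k"
        using mag_boundaries_diff[OF b(1) h] by blast
    qed
  qed
  then have "(\<lambda>c'. (\<lambda>b. b + c') ` mag_boundaries d B k) ` ((\<lambda>h. h + c) ` mag_boundaries d A k)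
      = {(\<lambda>b. b + c) ` mag_boundaries d B k}"
    using zero_in_mag_boundaries[of d A k] by (auto simp: image_image)
  then show ?thesis by (simp add: mag_incl_def r_coset_mag_cycle_group)
qed


subsection \<open>Short exact sequences\<close>

text \<open>
  The library's \<open>short_exact_sequence\<close> forces all groups to have elements of one type, which
  excludes the sequence with a direct product in the middle. This is the same notion for groups
  of different types, with the arguments in the order \<open>1 \<rightarrow> A \<rightarrow> B \<rightarrow> C \<rightarrow> 1\<close>.
\<close>

definition short_exact ::
    "'a monoid \<Rightarrow> 'b monoid \<Rightarrow> 'c monoid \<Rightarrow> ('a \<Rightarrow> 'b) \<Rightarrow> ('b \<Rightarrow> 'c) \<Rightarrow> bool" where
  "short_exact A B C f g \<longleftrightarrow>
     group_hom A B f \<and> group_hom B C g \<and>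
     inj_on f (carrier A) \<and> f ` carrier A = kernel B C g \<and> g ` carrier B = carrier C"

end

theory Submission
  imports Defs
begin

text \<open>
  The gate map \<open>\<pi>\<close> sends each point of \<open>Z\<close> to its gate in \<open>W = Y \<inter> Z\<close>. Gatedness together with
  the gluing condition says more than the existence of gates: \<open>\<pi> z\<close> lies between \<open>z\<close> and every
  point of \<open>Y\<close>, not only every point of \<open>W\<close>. Everything rests on two consequences of this.

  First, \<open>\<pi>\<close> does not increase distances and fixes \<open>W\<close>. Sending a path of \<open>Z\<close> to its image if every
  step keeps its length, and to \<open>0\<close> otherwise, is therefore a chain map from the complex of \<open>Z\<close> to
  that of \<open>W\<close> which is the identity on chains of \<open>W\<close> (\<open>retract_boundary\<close>, \<open>retract_fixes\<close>). Hence a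
  cycle of \<open>W\<close> that bounds in \<open>Z\<close> already bounds in \<open>W\<close>, so that the connecting map of a
  Mayer--Vietoris sequence vanishes.

  Second, every chain of \<open>X\<close> whose boundary is a sum of a chain of \<open>Y\<close> and a chain of \<open>Z\<close> is such a sum
  itself, up to a boundary (\<open>push_to_one_side\<close>); this is excision. Consider a path in which a point
  outside \<open>Z\<close> precedes a point outside \<open>Y\<close>, and let \<open>x\<close> be the first point outside \<open>Y\<close> for which this
  happens. The point before \<open>x\<close> lies in \<open>Y\<close>, so the gate of \<open>x\<close> may be inserted just before \<open>x\<close>.
  Inserting it where it is missing, with a sign, is a homotopy \<open>h\<close>, and \<open>c - \<partial>hc - h\<partial>c\<close> only involves
  paths whose first crossing is closer to the end than in \<open>c\<close>, or that have no crossing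
  (\<open>gate_homotopy_step\<close>). Iterating removes all
  crossings in this direction; reversing the paths and repeating the argument removes those in the
  other direction, and the paths that remain stay on one side.

  The exact sequence follows by diagram chasing. For a cycle \<open>u + v\<close> of \<open>X\<close> with \<open>u\<close> in \<open>Y\<close> and \<open>v\<close> in
  \<open>Z\<close>, the chain \<open>\<partial>u = - \<partial>v\<close> of \<open>W\<close> is the boundary of the projection of \<open>- v\<close> to \<open>W\<close>. Subtracting
  this projection from \<open>u\<close> and adding it to \<open>v\<close> gives cycles (\<open>cycle_splits\<close>). If \<open>u + v\<close> bounds a chain of \<open>X\<close>, that chain may be taken to be a sum of
  chains of \<open>Y\<close> and of \<open>Z\<close>, and \<open>u\<close> minus the boundary of the first summand is a cycle of \<open>W\<close>
  (\<open>boundary_splits\<close>).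
\<close>

section \<open>The magnitude complex is a chain complex\<close>

abbreviation delete_at :: "nat \<Rightarrow> 'a list \<Rightarrow> 'a list" where
  "delete_at i xs \<equiv> take i xs @ drop (Suc i) xs"

lemma nth_delete_at:
  assumes "i < length xs" "Suc j < length xs"
  shows "delete_at i xs ! j = (if j < i then xs ! j else xs ! Suc j)"
  using assms by (auto simp: nth_append min_def)

lemma delete_at_delete_at:
  assumes "i < j" "j < length xs"
  shows "delete_at i (delete_at j xs) = delete_at (j - 1) (delete_at i xs)"
proof -
  obtain m where "j = Suc (i + m)" using assms(1) less_iff_Suc_add by auto
  then show ?thesis using assms(2) by (simp add: drop_take min_def add.commute)
qed

lemma set_delete_at_subset: "set (delete_at i xs) \<subseteq> set xs"
  by (auto dest: in_set_takeD in_set_dropD)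

lemma mag_boundary_simps [simp]:
  "mag_boundary d k 0 = 0"
  "mag_boundary d k (a + b) = mag_boundary d k a + mag_boundary d k b"
  "mag_boundary d k (a - b) = mag_boundary d k a - mag_boundary d k b"
  "mag_boundary d k (- a) = - mag_boundary d k a"
  "mag_boundary d k (frag_cmul n a) = frag_cmul n (mag_boundary d k a)"
  by (simp_all add: mag_boundary_def frag_extend_add frag_extend_diff frag_extend_minus
      frag_extend_cmul)

lemma mag_boundary_frag_of:
  "mag_boundary d k (frag_of p) = (\<Sum>i\<in>{1..<k}. frag_cmul ((-1) ^ i) (mag_face d i p))"
  by (simp add: mag_boundary_def)

lemma frag_cmul_diff: "frag_cmul n (a - b) = frag_cmul n a - frag_cmul n b"
  using frag_cmul_distrib2[of n a "- b"] frag_cmul_cmul[of n "-1" b] minus_frag_cmul[of n b]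
  by simp

lemma frag_extend_sum_cmul:
  assumes "finite I"
  shows "frag_extend f (\<Sum>i\<in>I. frag_cmul (c i) (g i)) = (\<Sum>i\<in>I. frag_cmul (c i) (frag_extend f (g i)))"
  using assms by (simp add: frag_extend_sum frag_extend_cmul)

lemma frag_extend_of_sum:
  assumes "finite I"
  shows "frag_extend (\<lambda>p. \<Sum>i\<in>I. frag_cmul (c i) (g i p)) x =
    (\<Sum>i\<in>I. frag_cmul (c i) (frag_extend (g i) x))"
  using subset_UNIV
  by (induction x rule: frag_induction)
     (simp_all add: frag_extend_diff sum_subtractf frag_cmul_diff)

lemma keys_sum_subset:
  assumes "\<And>i. i \<in> I \<Longrightarrow> Poly_Mapping.keys (f i) \<subseteq> A"
  shows "Poly_Mapping.keys (\<Sum>i\<in>I. f i) \<subseteq> A"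
  using keys_sum[of f I] assms by blast

lemma keys_add_subset:
  "Poly_Mapping.keys a \<subseteq> A \<Longrightarrow> Poly_Mapping.keys b \<subseteq> A \<Longrightarrow> Poly_Mapping.keys (a + b) \<subseteq> A"
  using keys_add[of a b] by blast

lemma keys_diff_subset:
  "Poly_Mapping.keys a \<subseteq> A \<Longrightarrow> Poly_Mapping.keys b \<subseteq> A \<Longrightarrow>
    Poly_Mapping.keys (a - b :: _ \<Rightarrow>\<^sub>0 int) \<subseteq> A"
  using keys_diff[of a b] by blast

lemma keys_cmul_subset:
  "Poly_Mapping.keys a \<subseteq> A \<Longrightarrow> Poly_Mapping.keys (frag_cmul n a) \<subseteq> A"
  by auto

lemma keys_frag_extend_subset:
  assumes "Poly_Mapping.keys c \<subseteq> A" "\<And>p. p \<in> A \<Longrightarrow> Poly_Mapping.keys (f p) \<subseteq> B"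
  shows "Poly_Mapping.keys (frag_extend f c) \<subseteq> B"
  using keys_frag_extend[of f c] assms by blast

lemma keys_mag_boundary_subset:
  assumes "Poly_Mapping.keys c \<subseteq> A"
    and "\<And>p i. \<lbrakk>p \<in> A; 1 \<le> i; i < k\<rbrakk> \<Longrightarrow> Poly_Mapping.keys (mag_face d i p) \<subseteq> B"
  shows "Poly_Mapping.keys (mag_boundary d k c) \<subseteq> B"
  unfolding mag_boundary_def
  by (intro keys_frag_extend_subset[OF assms(1)] keys_sum_subset keys_cmul_subset)
     (use assms(2) in auto)

lemma keys_mag_face:
  "q \<in> Poly_Mapping.keys (mag_face d i p) \<Longrightarrow> q = delete_at i p"
  by (simp add: mag_face_def split: if_splits)

text \<open>
  The pair \<open>(i, j)\<close> with \<open>i < j\<close> cancels against \<open>(j - 1, i)\<close>, whose first entry is not below its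
  second and whose sign is the opposite one.
\<close>

lemma double_sum_cancel:
  fixes F :: "nat \<Rightarrow> nat \<Rightarrow> 'b \<Rightarrow>\<^sub>0 int"
  assumes "\<And>i j. \<lbrakk>1 \<le> i; i < j; j < k\<rbrakk> \<Longrightarrow> F i j = F (j - 1) i"
  shows "(\<Sum>j\<in>{1..<k}. \<Sum>i\<in>{1..<k - 1}. frag_cmul ((-1) ^ (i + j)) (F i j)) = 0"
proof -
  let ?f = "\<lambda>(j, i). frag_cmul ((-1) ^ (i + j)) (F i j)"
  let ?L = "{(j, i). 1 \<le> i \<and> i < j \<and> j < k}" and ?U = "{(j, i). 1 \<le> j \<and> j \<le> i \<and> i < k - 1}"
  have "finite ({..k} \<times> {..k})" by simp
  then have fin: "finite ?L" "finite ?U"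
    by (rule finite_subset[rotated], force)+
  have split: "{1..<k} \<times> {1..<k - 1} = ?L \<union> ?U" by auto
  have "sum ?f ?L = sum (\<lambda>x. - ?f x) ?U"
  proof (rule sum.reindex_bij_witness[of _ "\<lambda>(j, i). (Suc i, j)" "\<lambda>(j, i). (i, j - 1)"])
    fix a assume "a \<in> ?L"
    then obtain i j where ij: "a = (j, i)" "1 \<le> i" "i < j" "j < k" by auto
    have "(-1 :: int) ^ (i + (j - 1)) = - ((-1) ^ (i + j))"
      using ij by (cases j) auto
    moreover have "F i j = F (j - 1) i" using assms ij by blast
    ultimately show "- ?f (case a of (j, i) \<Rightarrow> (i, j - 1)) = ?f a"
      unfolding ij(1) prod.case by (simp only: minus_frag_cmul add.commute[of _ i] minus_minus)
  next
    fix a assume "a \<in> ?L"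
    then show "(case case a of (j, i) \<Rightarrow> (i, j - 1) of (j, i) \<Rightarrow> (Suc i, j)) = a"
      "(case a of (j, i) \<Rightarrow> (i, j - 1)) \<in> ?U"
      by auto
  next
    fix a assume "a \<in> ?U"
    then show "(case case a of (j, i) \<Rightarrow> (Suc i, j) of (j, i) \<Rightarrow> (i, j - 1)) = a"
      "(case a of (j, i) \<Rightarrow> (Suc i, j)) \<in> ?L"
      by auto
  qed
  moreover have "sum ?f (?L \<union> ?U) = sum ?f ?L + sum ?f ?U"
    using fin by (rule sum.union_disjoint) auto
  ultimately have "sum ?f (?L \<union> ?U) = 0"
    by (simp only: sum_negf add.left_inverse)
  then have "sum ?f ({1..<k} \<times> {1..<k - 1}) = 0" by (simp only: split)
  then show ?thesis by (simp only: sum.cartesian_product)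
qed

context Metric_space
begin

text \<open>
  Deleting a point could bring two equal points together. The betweenness condition excludes this:
  the distance between the neighbours of the deleted point is a sum of two positive numbers.
\<close>

lemma keys_mag_face_paths:
  assumes "A \<subseteq> M" "p \<in> mag_paths A k" "1 \<le> i" "i < k"
  shows "Poly_Mapping.keys (mag_face d i p) \<subseteq> mag_paths A (k - 1)"
proof (cases "metric_between d (p ! (i - 1)) (p ! i) (p ! (i + 1))")
  case True
  have len: "length p = Suc k" and sub: "set p \<subseteq> A" and adj: "distinct_adj p"
    using assms(2) by (auto simp: mag_paths_def)
  have mem: "p ! n \<in> M" if "n \<le> k" for n
    using that len sub assms(1) nth_mem[of n p] by (auto intro!: subsetD[OF assms(1)] subsetD[OF sub])
  have ne: "p ! n \<noteq> p ! Suc n" if "n < k" for n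
    using distinct_adj_nth[OF adj] that len by simp
  have skip: "p ! (i - 1) \<noteq> p ! (i + 1)"
  proof
    assume "p ! (i - 1) = p ! (i + 1)"
    then have "d (p ! (i - 1)) (p ! i) + d (p ! i) (p ! (i + 1)) = 0"
      using True mem[of "i + 1"] assms by (simp add: metric_between_def)
    moreover have "d (p ! i) (p ! (i + 1)) > 0"
      using mem ne[of i] assms by simp
    ultimately show False
      using nonneg[of "p ! (i - 1)" "p ! i"] by linarith
  qed
  have "distinct_adj (delete_at i p)"
    unfolding distinct_adj_conv_nth
  proof (intro allI impI)
    fix n assume n: "Suc n < length (delete_at i p)"
    then have n': "Suc (Suc n) < length p" using len assms by auto
    have "delete_at i p ! n = (if n < i then p ! n else p ! Suc n)"
      and "delete_at i p ! Suc n = (if Suc n < i then p ! Suc n else p ! Suc (Suc n))"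
      using nth_delete_at[of i p n] nth_delete_at[of i p "Suc n"] n' len assms by auto
    moreover have "p ! n \<noteq> p ! Suc (Suc n)" if "n < i" "\<not> Suc n < i"
      using skip that by (cases "Suc n = i") auto
    ultimately show "delete_at i p ! n \<noteq> delete_at i p ! Suc n"
      using ne[of n] ne[of "Suc n"] n' len by (auto simp del: take_Suc drop_Suc split: if_splits)
  qed
  moreover have "length (delete_at i p) = Suc (k - 1)" using len assms by auto
  moreover have "set (delete_at i p) \<subseteq> A" using set_delete_at_subset[of i p] sub by blast
  ultimately show ?thesis by (auto simp: mag_face_def mag_paths_def)
qed (simp add: mag_face_def)

lemma keys_mag_boundary_paths:
  assumes "A \<subseteq> M" "Poly_Mapping.keys c \<subseteq> mag_paths A k"
  shows "Poly_Mapping.keys (mag_boundary d k c) \<subseteq> mag_paths A (k - 1)"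
  by (rule keys_mag_boundary_subset[OF assms(2)]) (rule keys_mag_face_paths[OF assms(1)])

text \<open>
  For neighbouring positions this is the four-point exchange: deleting \<open>c\<close> and then \<open>b\<close> from
  \<open>a, b, c, e\<close> is admissible exactly if \<open>d a e = d a b + d b c + d c e\<close>, and so is the other order.
\<close>

lemma mag_face_commute:
  assumes "p \<in> mag_paths M k" "1 \<le> i" "i < j" "j < k"
  shows "frag_extend (mag_face d i) (mag_face d j p) =
    frag_extend (mag_face d (j - 1)) (mag_face d i p)"
proof -
  have len: "length p = Suc k" and sub: "set p \<subseteq> M"
    using assms(1) by (auto simp: mag_paths_def)
  have mem: "p ! n \<in> M" if "n \<le> k" for n
    using that len sub nth_mem[of n p] by auto
  let ?q = "delete_at j p" and ?r = "delete_at i p"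
  have q: "?q ! (i - 1) = p ! (i - 1)" "?q ! i = p ! i"
    "?q ! (i + 1) = (if j = i + 1 then p ! (j + 1) else p ! (i + 1))"
    using assms len by (auto simp: nth_append min_def)
  have r: "?r ! (j - 1 - 1) = (if j = i + 1 then p ! (i - 1) else p ! (j - 1))"
    "?r ! (j - 1) = p ! j" "?r ! (j - 1 + 1) = p ! (j + 1)"
    using nth_delete_at[of i p "j - 2"] nth_delete_at[of i p "j - 1"] nth_delete_at[of i p j]
      assms len by (auto simp: numeral_2_eq_2 Suc_diff_Suc)
  have dd: "delete_at i ?q = delete_at (j - 1) ?r"
    using delete_at_delete_at[of i j p] assms len by simp
  have exch: "metric_between d (p ! (j - 1)) (p ! j) (p ! (j + 1)) \<and>
      metric_between d (p ! (i - 1)) (p ! i) (?q ! (i + 1)) \<longleftrightarrow>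
    metric_between d (p ! (i - 1)) (p ! i) (p ! (i + 1)) \<and>
      metric_between d (?r ! (j - 1 - 1)) (p ! j) (p ! (j + 1))"
  proof (cases "j = i + 1")
    case True
    let ?a = "p ! (i - 1)" and ?b = "p ! i" and ?c = "p ! (i + 1)" and ?e = "p ! (i + 2)"
    have "?a \<in> M" "?b \<in> M" "?c \<in> M" "?e \<in> M" using mem assms True by auto
    then have "d ?a ?e \<le> d ?a ?c + d ?c ?e" "d ?a ?e \<le> d ?a ?b + d ?b ?e"
        "d ?a ?c \<le> d ?a ?b + d ?b ?c" "d ?b ?e \<le> d ?b ?c + d ?c ?e"
      by (simp_all add: triangle)
    then show ?thesis
      using True unfolding q r metric_between_def by auto
  next
    case False
    then show ?thesis unfolding q r by auto
  qed
  show ?thesis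
  proof -
    have "frag_extend (mag_face d i) (mag_face d j p) =
        (if metric_between d (p ! (j - 1)) (p ! j) (p ! (j + 1)) then mag_face d i ?q else 0)"
      unfolding mag_face_def[of d j p] by (auto simp del: One_nat_def)
    moreover have "frag_extend (mag_face d (j - 1)) (mag_face d i p) =
        (if metric_between d (p ! (i - 1)) (p ! i) (p ! (i + 1)) then mag_face d (j - 1) ?r else 0)"
      unfolding mag_face_def[of d i p] by (auto simp del: One_nat_def)
    moreover have "mag_face d i ?q =
        (if metric_between d (p ! (i - 1)) (p ! i) (?q ! (i + 1))
         then frag_of (delete_at i ?q) else 0)"
      unfolding mag_face_def q(1,2) ..
    moreover have "mag_face d (j - 1) ?r =
        (if metric_between d (?r ! (j - 1 - 1)) (p ! j) (p ! (j + 1))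
         then frag_of (delete_at (j - 1) ?r) else 0)"
      unfolding mag_face_def r(2,3) ..
    ultimately show ?thesis using exch dd by presburger
  qed
qed

lemma mag_boundary_boundary:
  assumes "Poly_Mapping.keys c \<subseteq> mag_paths M k"
  shows "mag_boundary d (k - 1) (mag_boundary d k c) = 0"
  using assms
proof (induction c rule: frag_induction)
  case (one p)
  have "mag_boundary d (k - 1) (mag_boundary d k (frag_of p)) =
      (\<Sum>j\<in>{1..<k}. frag_cmul ((-1) ^ j) (\<Sum>i\<in>{1..<k - 1}. frag_cmul ((-1) ^ i)
        (frag_extend (mag_face d i) (mag_face d j p))))"
  proof -
    have "mag_boundary d (k - 1) (mag_boundary d k (frag_of p)) =
        (\<Sum>j\<in>{1..<k}. frag_cmul ((-1) ^ j) (mag_boundary d (k - 1) (mag_face d j p)))"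
      unfolding mag_boundary_frag_of
      by (simp add: mag_boundary_def frag_extend_sum_cmul)
    then show ?thesis
      by (simp only: mag_boundary_def frag_extend_of_sum[OF finite_atLeastLessThan])
  qed
  also have "\<dots> = (\<Sum>j\<in>{1..<k}. \<Sum>i\<in>{1..<k - 1}. frag_cmul ((-1) ^ (i + j))
        (frag_extend (mag_face d i) (mag_face d j p)))"
    by (simp add: frag_cmul_sum power_add mult.commute)
  also have "\<dots> = 0"
    by (rule double_sum_cancel) (rule mag_face_commute[OF one])
  finally show ?case .
qed simp_all

end

section \<open>Projection to the gates\<close>

text \<open>
  The last assumption lets \<open>y\<close> range over all of \<open>Y\<close>. It is how gatedness and the gluing condition
  are used from here on.
\<close>

locale gate_projection = Metric_space X d
  for X :: "'a set" and d :: "'a \<Rightarrow> 'a \<Rightarrow> real" +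
  fixes Y Z :: "'a set" and \<pi> :: "'a \<Rightarrow> 'a"
  assumes cover: "X = Y \<union> Z"
    and gate_mem: "z \<in> Z \<Longrightarrow> \<pi> z \<in> Y \<inter> Z"
    and gate_between: "\<lbrakk>y \<in> Y; z \<in> Z\<rbrakk> \<Longrightarrow> d y z = d y (\<pi> z) + d (\<pi> z) z"
begin

lemma gate_fixed:
  assumes "w \<in> Y \<inter> Z" shows "\<pi> w = w"
proof -
  have m: "w \<in> X" "\<pi> w \<in> X" using assms gate_mem[of w] cover by auto
  have "d w w = d w (\<pi> w) + d (\<pi> w) w" using gate_between assms by blast
  then have "d w (\<pi> w) = 0" using m nonneg[of w "\<pi> w"] nonneg[of "\<pi> w" w] mdist_zero[of w] by linarith
  then show ?thesis using m by simp
qed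

text \<open>
  Going from \<open>\<pi> x\<close> to \<open>z\<close> passes through \<open>\<pi> z\<close>, and going from \<open>\<pi> z\<close> to \<open>x\<close> passes through \<open>\<pi> x\<close>.
  Comparing both with the detours through \<open>x\<close> and \<open>z\<close> and adding up gives twice the claim.
\<close>

lemma gate_nonexpansive:
  assumes "x \<in> Z" "z \<in> Z" shows "d (\<pi> x) (\<pi> z) \<le> d x z"
proof -
  have m: "x \<in> X" "z \<in> X" "\<pi> x \<in> X" "\<pi> z \<in> X" using assms gate_mem cover by auto
  have "d (\<pi> x) z = d (\<pi> x) (\<pi> z) + d (\<pi> z) z" "d (\<pi> z) x = d (\<pi> z) (\<pi> x) + d (\<pi> x) x"
    using gate_between gate_mem assms by blast+
  moreover have "d (\<pi> x) z \<le> d (\<pi> x) x + d x z" "d (\<pi> z) x \<le> d (\<pi> z) z + d z x"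
    using m triangle by blast+
  ultimately show ?thesis using commute[of "\<pi> z" "\<pi> x"] commute[of z x] by linarith
qed

definition isometric_along :: "'a list \<Rightarrow> bool" where
  "isometric_along p \<longleftrightarrow>
     (\<forall>n. Suc n < length p \<longrightarrow> d (\<pi> (p ! n)) (\<pi> (p ! Suc n)) = d (p ! n) (p ! Suc n))"

text \<open>
  This is the map that a distance-decreasing map induces on magnitude chains: a path whose length
  drops goes to \<open>0\<close>. In particular the image of a path, if nonzero, has no stationary steps.
\<close>

definition retract_path :: "'a list \<Rightarrow> 'a list \<Rightarrow>\<^sub>0 int" where
  "retract_path p = (if isometric_along p then frag_of (map \<pi> p) else 0)"

definition retract :: "('a list \<Rightarrow>\<^sub>0 int) \<Rightarrow> 'a list \<Rightarrow>\<^sub>0 int" where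
  "retract = frag_extend retract_path"

lemma keys_retract_path:
  assumes "p \<in> mag_paths Z k"
  shows "Poly_Mapping.keys (retract_path p) \<subseteq> mag_paths (Y \<inter> Z) k"
proof (cases "isometric_along p")
  case True
  have p: "length p = Suc k" "set p \<subseteq> Z" "distinct_adj p"
    using assms by (auto simp: mag_paths_def)
  have "distinct_adj (map \<pi> p)"
    unfolding distinct_adj_conv_nth
  proof (intro allI impI)
    fix n assume n: "Suc n < length (map \<pi> p)"
    then have m: "p ! n \<in> Z" "p ! Suc n \<in> Z" using p nth_mem[of n p] nth_mem[of "Suc n" p] by auto
    then have X: "p ! n \<in> X" "p ! Suc n \<in> X" "\<pi> (p ! n) \<in> X" "\<pi> (p ! Suc n) \<in> X"
      using cover gate_mem by auto
    have "p ! n \<noteq> p ! Suc n" using p n distinct_adj_nth[of p n] by simp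
    then have "0 < d (p ! n) (p ! Suc n)" using X by simp
    also have "\<dots> = d (\<pi> (p ! n)) (\<pi> (p ! Suc n))"
      using True n by (simp add: isometric_along_def)
    finally show "map \<pi> p ! n \<noteq> map \<pi> p ! Suc n" using X n by auto
  qed
  then show ?thesis
    using p gate_mem by (auto simp: retract_path_def mag_paths_def)
qed (simp add: retract_path_def)

lemma keys_retract:
  assumes "Poly_Mapping.keys c \<subseteq> mag_paths Z k"
  shows "Poly_Mapping.keys (retract c) \<subseteq> mag_paths (Y \<inter> Z) k"
  unfolding retract_def by (rule keys_frag_extend_subset[OF assms keys_retract_path])

lemma retract_fixes:
  assumes "Poly_Mapping.keys c \<subseteq> lists (Y \<inter> Z)"
  shows "retract c = c"
  using assms
proof (induction c rule: frag_induction)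
  case (one p)
  then have *: "\<pi> x = x" if "x \<in> set p" for x using that gate_fixed by auto
  then have "map \<pi> p = p" by (intro map_idI)
  moreover have "isometric_along p" by (simp add: isometric_along_def *)
  ultimately show ?case by (simp add: retract_def retract_path_def)
qed (simp_all add: retract_def frag_extend_diff)

text \<open>
  Suppose the deleted point lies between its neighbours. If a step next to it shrinks, the images
  of the neighbours are closer than the neighbours, so both sides are \<open>0\<close>; if neither shrinks, the
  new step keeps its length exactly if the image of the deleted point lies between the images of its
  neighbours. A step elsewhere that shrinks makes both sides \<open>0\<close>. Conversely, along steps of unchanged length, betweenness of the images forces
  betweenness of the points, as \<open>\<pi>\<close> cannot increase the distance of the neighbours.
\<close>

lemma retract_face:
  assumes "p \<in> mag_paths Z k" "1 \<le> i" "i < k"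
  shows "retract (mag_face d i p) = (if isometric_along p then mag_face d i (map \<pi> p) else 0)"
proof -
  have len: "length p = Suc k" and sub: "set p \<subseteq> Z" using assms(1) by (auto simp: mag_paths_def)
  have mem: "p ! n \<in> Z" if "n \<le> k" for n using that len sub nth_mem[of n p] by auto
  have le: "d (\<pi> (p ! m)) (\<pi> (p ! n)) \<le> d (p ! m) (p ! n)" if "m \<le> k" "n \<le> k" for m n
    using gate_nonexpansive mem that by blast
  obtain j where j: "i = Suc j" using assms(2) by (cases i) auto
  let ?a = "p ! j" and ?b = "p ! Suc j" and ?c = "p ! Suc (Suc j)"
  have in_X: "?a \<in> X" "?b \<in> X" "?c \<in> X" "\<pi> ?a \<in> X" "\<pi> ?b \<in> X" "\<pi> ?c \<in> X"
    using mem gate_mem cover j assms(3) by auto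
  note tri = triangle[OF in_X(1,2,3)] triangle[OF in_X(4,5,6)]
    le[of j "Suc j"] le[of "Suc j" "Suc (Suc j)"] le[of j "Suc (Suc j)"]
  have bound: "j \<le> k" "Suc j \<le> k" "Suc (Suc j) \<le> k" using j assms(3) by auto
  have iso_del: "isometric_along (delete_at i p) \<longleftrightarrow>
     (\<forall>n. Suc n < length p \<and> n \<noteq> j \<and> n \<noteq> Suc j \<longrightarrow>
         d (\<pi> (p ! n)) (\<pi> (p ! Suc n)) = d (p ! n) (p ! Suc n)) \<and>
     d (\<pi> ?a) (\<pi> ?c) = d ?a ?c" (is "_ \<longleftrightarrow> ?R")
  proof
    assume iso: "isometric_along (delete_at i p)"
    have *: "d (\<pi> (delete_at i p ! n)) (\<pi> (delete_at i p ! Suc n)) =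
        d (delete_at i p ! n) (delete_at i p ! Suc n)" if "n < k - 1" for n
      using iso that len j assms(3) by (simp add: isometric_along_def)
    have nth: "delete_at i p ! n = (if n < i then p ! n else p ! Suc n)" if "n < k" for n
      by (rule nth_delete_at) (use that len assms in auto)
    have "d (\<pi> (p ! n)) (\<pi> (p ! Suc n)) = d (p ! n) (p ! Suc n)"
      if n: "Suc n < length p" "n \<noteq> j" "n \<noteq> Suc j" for n
    proof (cases "n < j")
      case True
      then show ?thesis using *[of n] nth[of n] nth[of "Suc n"] n len j assms(3) by simp
    next
      case False
      then obtain m where m: "n = Suc m" "Suc j \<le> m" using n False by (cases n) auto
      then show ?thesis using *[of m] nth[of m] nth[of "Suc m"] n len j assms(3) by simp
    qed
    moreover have "d (\<pi> ?a) (\<pi> ?c) = d ?a ?c"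
      using *[of j] nth[of j] nth[of "Suc j"] j assms(3) by simp
    ultimately show ?R by blast
  next
    assume R: ?R
    show "isometric_along (delete_at i p)"
      unfolding isometric_along_def
    proof (intro allI impI)
      fix n assume n: "Suc n < length (delete_at i p)"
      then have nk: "Suc n < k" using len j assms(3) by simp
      have nth: "delete_at i p ! m = (if m < i then p ! m else p ! Suc m)" if "m < k" for m
        by (rule nth_delete_at) (use that len assms in auto)
      show "d (\<pi> (delete_at i p ! n)) (\<pi> (delete_at i p ! Suc n)) =
          d (delete_at i p ! n) (delete_at i p ! Suc n)"
        using R nk len j nth[of n] nth[of "Suc n"] by (cases "n = j") auto
    qed
  qed
  have iso: "isometric_along p \<longleftrightarrow>
     (\<forall>n. Suc n < length p \<and> n \<noteq> j \<and> n \<noteq> Suc j \<longrightarrow>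
         d (\<pi> (p ! n)) (\<pi> (p ! Suc n)) = d (p ! n) (p ! Suc n)) \<and>
     d (\<pi> ?a) (\<pi> ?b) = d ?a ?b \<and> d (\<pi> ?b) (\<pi> ?c) = d ?b ?c"
    using len j assms(3) unfolding isometric_along_def by auto
  have "d ?a ?c = d ?a ?b + d ?b ?c \<and> d (\<pi> ?a) (\<pi> ?c) = d ?a ?c \<longleftrightarrow>
      d (\<pi> ?a) (\<pi> ?b) = d ?a ?b \<and> d (\<pi> ?b) (\<pi> ?c) = d ?b ?c \<and>
      d (\<pi> ?a) (\<pi> ?c) = d (\<pi> ?a) (\<pi> ?b) + d (\<pi> ?b) (\<pi> ?c)"
    using tri bound by auto
  then have equiv: "metric_between d (p ! (i - 1)) (p ! i) (p ! (i + 1)) \<and>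
        isometric_along (delete_at i p) \<longleftrightarrow>
      isometric_along p \<and> metric_between d (map \<pi> p ! (i - 1)) (map \<pi> p ! i) (map \<pi> p ! (i + 1))"
    using j len assms(3) unfolding iso_del iso metric_between_def by auto
  have "map \<pi> (delete_at i p) = delete_at i (map \<pi> p)"
    by (simp add: take_map drop_map)
  then show ?thesis
    using equiv unfolding mag_face_def retract_def
    by (auto simp: retract_path_def simp del: map_append One_nat_def)
qed

lemma retract_boundary:
  assumes "Poly_Mapping.keys c \<subseteq> mag_paths Z k"
  shows "retract (mag_boundary d k c) = mag_boundary d k (retract c)"
  using assms
proof (induction c rule: frag_induction)
  case (one p)
  have "retract (mag_boundary d k (frag_of p)) =
      (\<Sum>i\<in>{1..<k}. frag_cmul ((-1) ^ i) (retract (mag_face d i p)))"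
    unfolding mag_boundary_frag_of retract_def by (simp add: frag_extend_sum_cmul)
  also have "\<dots> = (\<Sum>i\<in>{1..<k}. frag_cmul ((-1) ^ i)
      (if isometric_along p then mag_face d i (map \<pi> p) else 0))"
    using retract_face[OF one] by (intro sum.cong) auto
  also have "\<dots> = mag_boundary d k (retract (frag_of p))"
    by (auto simp: retract_def retract_path_def mag_boundary_frag_of)
  finally show ?case .
qed (simp_all add: retract_def frag_extend_diff)

end

section \<open>Paths that change sides\<close>

context gate_projection
begin

text \<open>
  Only the order from the side of \<open>Y\<close> to the side of \<open>Z\<close> counts, so that the gate can always be
  inserted in front of the point of \<open>Z\<close>. The opposite order is a crossing of the reversed list.
\<close>

primrec crosses :: "'a list \<Rightarrow> bool" where
  "crosses [] = False"
| "crosses (x # xs) = (x \<notin> Z \<and> (\<exists>y\<in>set xs. y \<notin> Y) \<or> crosses xs)"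

lemma crosses_append:
  "crosses (xs @ ys) \<longleftrightarrow>
     crosses xs \<or> crosses ys \<or> (\<exists>x\<in>set xs. x \<notin> Z) \<and> (\<exists>y\<in>set ys. y \<notin> Y)"
  by (induction xs) auto

lemma crosses_delete_at:
  assumes "crosses (delete_at i p)" shows "crosses p"
proof (cases "i < length p")
  case True
  then have "p = take i p @ p ! i # drop (Suc i) p" by (rule id_take_nth_drop)
  then show ?thesis using assms crosses_append[of "take i p"] by (metis crosses.simps(2) list.set_intros(2))
qed (use assms in simp)

lemma not_crosses_if_one_side:
  assumes "set p \<subseteq> Y \<or> set p \<subseteq> Z" shows "\<not> crosses p"
  using assms by (induction p) auto

lemma one_side_if_not_crosses:
  assumes "set p \<subseteq> X" "\<not> crosses p" "\<not> crosses (rev p)"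
  shows "set p \<subseteq> Y \<or> set p \<subseteq> Z"
proof (rule ccontr)
  assume "\<not> ?thesis"
  then obtain y z where yz: "y \<in> set p" "y \<notin> Z" "z \<in> set p" "z \<notin> Y" by blast
  then obtain u v where p: "p = u @ y # v" by (meson split_list)
  have "z \<noteq> y" using yz assms(1) cover by blast
  then have "z \<in> set u \<or> z \<in> set v" using yz p by auto
  then show False using assms(2,3) yz p by (auto simp: crosses_append)
qed

definition first_crossing :: "'a list \<Rightarrow> 'a \<Rightarrow> bool" where
  "first_crossing s x \<longleftrightarrow> \<not> crosses s \<and> (\<exists>y\<in>set s. y \<notin> Z) \<and> x \<notin> Y"

lemma crosses_split:
  assumes "crosses p"
  obtains s x t where "p = s @ x # t" "first_crossing s x"
proof -
  have "\<exists>s x t. p = s @ x # t \<and> first_crossing s x"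
    using assms
  proof (induction p rule: rev_induct)
    case (snoc x p)
    show ?case
    proof (cases "crosses p")
      case True
      then show ?thesis using snoc.IH by (metis append.assoc append_Cons)
    next
      case False
      then have "first_crossing p x"
        using snoc.prems by (auto simp: crosses_append first_crossing_def)
      then show ?thesis by blast
    qed
  qed simp
  then show thesis using that by blast
qed

lemma crosses_if_first_crossing: "first_crossing s x \<Longrightarrow> crosses (s @ x # t)"
  by (auto simp: first_crossing_def crosses_append)

text \<open>
  If the last point of \<open>s\<close> were outside \<open>Y\<close>, then \<open>s\<close> itself would contain a crossing. That it is
  in \<open>Y\<close> is what allows the gate of \<open>x\<close> to be inserted after it.
\<close>

lemma last_in_if_first_crossing:
  assumes "first_crossing s x" "set s \<subseteq> X"
  shows "s \<noteq> []" "last s \<in> Y"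
proof -
  show "s \<noteq> []" using assms(1) by (auto simp: first_crossing_def)
  then obtain u c where s: "s = u @ [c]" by (meson rev_exhaust)
  then show "last s \<in> Y"
    using assms cover by (auto simp: first_crossing_def crosses_append)
qed

text \<open>
  The position of the first point outside \<open>Y\<close> that comes after a point outside \<open>Z\<close>. It is meaningful
  only for lists with a crossing.
\<close>

definition crossing_index :: "'a list \<Rightarrow> nat" where
  "crossing_index p = (LEAST i. crosses (take (Suc i) p))"

lemma crossing_index_split:
  assumes "first_crossing s x"
  shows "crossing_index (s @ x # t) = length s"
  unfolding crossing_index_def
proof (rule Least_equality)
  show "crosses (take (Suc (length s)) (s @ x # t))"
    using crosses_if_first_crossing[OF assms, of "[]"] by simp
next
  fix i assume i: "crosses (take (Suc i) (s @ x # t))"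
  show "length s \<le> i"
  proof (rule ccontr)
    assume "\<not> length s \<le> i"
    then have "crosses (take (Suc i) s)" using i by simp
    then have "crosses s" using crosses_append[of "take (Suc i) s" "drop (Suc i) s"] by simp
    then show False using assms by (simp add: first_crossing_def)
  qed
qed

text \<open>
  The sign makes the face that removes the inserted gate again come out as \<open>+ p\<close>. Lists that already
  have the gate in front of the crossing are sent to \<open>0\<close>: they are what insertion produces.
\<close>

definition insert_gate :: "'a list \<Rightarrow> 'a list \<Rightarrow>\<^sub>0 int" where
  "insert_gate p =
     (let i = crossing_index p; g = \<pi> (p ! i) in
      if crosses p \<and> p ! (i - 1) \<noteq> g
      then frag_cmul ((-1) ^ i) (frag_of (take i p @ g # drop i p)) else 0)"

definition gate_homotopy :: "('a list \<Rightarrow>\<^sub>0 int) \<Rightarrow> 'a list \<Rightarrow>\<^sub>0 int" where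
  "gate_homotopy = frag_extend insert_gate"

lemma gate_homotopy_simps [simp]:
  "gate_homotopy 0 = 0"
  "gate_homotopy (frag_of p) = insert_gate p"
  "gate_homotopy (a - b) = gate_homotopy a - gate_homotopy b"
  "gate_homotopy (frag_cmul n a) = frag_cmul n (gate_homotopy a)"
  by (simp_all add: gate_homotopy_def frag_extend_diff frag_extend_cmul)

lemma insert_gate_split:
  assumes "first_crossing s x"
  shows "insert_gate (s @ x # t) =
    (if last s = \<pi> x then 0
     else frag_cmul ((-1) ^ length s) (frag_of (s @ \<pi> x # x # t)))"
proof -
  have "s \<noteq> []" using assms by (auto simp: first_crossing_def)
  then have "(s @ x # t) ! (length s - 1) = last s" by (simp add: nth_append last_conv_nth)
  then show ?thesis
    using crosses_if_first_crossing[OF assms, of t]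
    by (simp add: insert_gate_def crossing_index_split[OF assms] Let_def)
qed

lemma insert_gate_not_crosses: "\<not> crosses p \<Longrightarrow> insert_gate p = 0"
  by (simp add: insert_gate_def)

lemma gate_of_crossing:
  assumes "first_crossing s x" "x \<in> X"
  shows "x \<in> Z" "\<pi> x \<in> Y" "\<pi> x \<in> Z" "\<pi> x \<noteq> x" "\<pi> x \<in> X"
proof -
  show "x \<in> Z" using assms cover by (auto simp: first_crossing_def)
  from gate_mem[OF this] show "\<pi> x \<in> Y" "\<pi> x \<in> Z" "\<pi> x \<in> X" using cover by auto
  then show "\<pi> x \<noteq> x" using assms by (auto simp: first_crossing_def)
qed

lemma keys_insert_gate_cases:
  assumes "q \<in> Poly_Mapping.keys (insert_gate p)"
  obtains s x t where "p = s @ x # t" "first_crossing s x" "last s \<noteq> \<pi> x"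
    "q = s @ \<pi> x # x # t"
proof -
  have "crosses p" using assms insert_gate_not_crosses by fastforce
  then obtain s x t where p: "p = s @ x # t" "first_crossing s x" by (rule crosses_split)
  then show thesis
    using that[OF p] assms by (auto simp: insert_gate_split split: if_splits)
qed

lemma keys_insert_gate_paths:
  assumes "p \<in> mag_paths X k"
  shows "Poly_Mapping.keys (insert_gate p) \<subseteq> mag_paths X (Suc k)"
proof
  fix q assume "q \<in> Poly_Mapping.keys (insert_gate p)"
  then obtain s x t where p: "p = s @ x # t" "first_crossing s x" "last s \<noteq> \<pi> x"
    and q: "q = s @ \<pi> x # x # t"
    by (rule keys_insert_gate_cases)
  have "x \<in> X" using assms p by (auto simp: mag_paths_def)
  note g = gate_of_crossing[OF p(2) this]
  show "q \<in> mag_paths X (Suc k)"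
    using assms p q g by (auto simp: mag_paths_def distinct_adj_append_iff)
qed

text \<open>
  The homotopy is controlled by the number of points from the first crossing to the end of the
  list. It is expressed through a prefix without crossings, which avoids a case distinction for
  lists that do not cross at all.
\<close>

definition crosses_late :: "nat \<Rightarrow> 'a list \<Rightarrow> bool" where
  "crosses_late n p \<longleftrightarrow> (\<exists>u v. p = u @ v \<and> \<not> crosses u \<and> length v \<le> n)"

lemma crosses_late_mono: "crosses_late m p \<Longrightarrow> m \<le> n \<Longrightarrow> crosses_late n p"
  unfolding crosses_late_def using le_trans by blast

lemma crosses_late_0: "crosses_late 0 p \<longleftrightarrow> \<not> crosses p"
  by (auto simp: crosses_late_def)

lemma not_crosses_late: "\<not> crosses p \<Longrightarrow> crosses_late n p"
  using crosses_late_0 crosses_late_mono by blast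

lemma crosses_late_all: "length p \<le> n \<Longrightarrow> crosses_late n p"
  unfolding crosses_late_def by (intro exI[of _ "[]"] exI[of _ p]) simp

text \<open>
  A prefix without crossings cannot reach the first crossing.
\<close>

lemma crosses_late_split:
  assumes "crosses_late n (s @ x # t)" "first_crossing s x"
  shows "length t < n"
proof -
  obtain u v where uv: "s @ x # t = u @ v" "\<not> crosses u" "length v \<le> n"
    using assms(1) by (auto simp: crosses_late_def)
  have "length u \<le> length s"
  proof (rule ccontr)
    assume "\<not> ?thesis"
    then have "\<exists>w. u = s @ x # w"
      using uv(1) by (auto simp: append_eq_append_conv2 Cons_eq_append_conv)
    then show False using crosses_if_first_crossing[OF assms(2)] uv(2) by blast
  qed
  then show ?thesis using arg_cong[OF uv(1), of length] uv(3) by simp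
qed

definition late_lists :: "nat \<Rightarrow> 'a list set" where
  "late_lists n = {p \<in> lists X. crosses_late n p}"

lemma late_listsI:
  assumes "set u \<subseteq> X" "set v \<subseteq> X" "\<not> crosses u" "length v \<le> n"
  shows "u @ v \<in> late_lists n"
proof -
  have "crosses_late n (u @ v)" unfolding crosses_late_def using assms(3,4) by blast
  then show ?thesis using assms(1,2) by (simp add: late_lists_def lists_eq_set)
qed

lemma late_listsD:
  "p \<in> late_lists n \<Longrightarrow> crosses_late n p" "p \<in> late_lists n \<Longrightarrow> set p \<subseteq> X"
  by (simp_all add: late_lists_def lists_eq_set)

text \<open>
  The gate is inserted before the first crossing and lies in \<open>Y \<inter> Z\<close>, so the part from the first
  crossing to the end does not change.
\<close>

lemma keys_insert_gate_late:
  assumes "p \<in> late_lists n"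
  shows "Poly_Mapping.keys (insert_gate p) \<subseteq> late_lists n"
proof
  fix q assume "q \<in> Poly_Mapping.keys (insert_gate p)"
  then obtain s x t where p: "p = s @ x # t" "first_crossing s x"
    and q: "q = s @ \<pi> x # x # t"
    by (rule keys_insert_gate_cases)
  have sub: "set p \<subseteq> X" using late_listsD(2)[OF assms] .
  then have x: "x \<in> X" and st: "set s \<subseteq> X" "set t \<subseteq> X" using p by auto
  note g = gate_of_crossing[OF p(2) x]
  have "length t < n" using crosses_late_split[of n s x t] late_listsD(1)[OF assms] p by simp
  moreover have "\<not> crosses (s @ [\<pi> x])"
    using p(2) g by (simp add: crosses_append first_crossing_def)
  ultimately have "(s @ [\<pi> x]) @ x # t \<in> late_lists n"
    using st x g by (intro late_listsI) auto
  then show "q \<in> late_lists n" using q by simp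
qed

lemma keys_gate_homotopy_late:
  assumes "Poly_Mapping.keys c \<subseteq> late_lists n"
  shows "Poly_Mapping.keys (gate_homotopy c) \<subseteq> late_lists n"
  unfolding gate_homotopy_def
  by (rule keys_frag_extend_subset[OF assms keys_insert_gate_late])

lemma crosses_late_delete_at:
  assumes "\<not> crosses s" "length s \<le> j" "j < length s + length r"
  shows "crosses_late (length r - 1) (delete_at j (s @ r))"
proof -
  have "delete_at j (s @ r) = s @ delete_at (j - length s) r"
    using assms(2) by (simp add: Suc_diff_le)
  moreover have "length (delete_at (j - length s) r) \<le> length r - 1"
    using assms(2,3) by auto
  ultimately show ?thesis using assms(1) unfolding crosses_late_def by blast
qed

lemma keys_mag_face_subset: "delete_at i p \<in> A \<Longrightarrow> Poly_Mapping.keys (mag_face d i p) \<subseteq> A"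
  by (auto simp: mag_face_def)

lemma keys_mag_face_after:
  assumes "set (s @ r) \<subseteq> X" "\<not> crosses s" "length s \<le> j" "j < length s + length r"
  shows "Poly_Mapping.keys (mag_face d j (s @ r)) \<subseteq> late_lists (length r - 1)"
proof (rule keys_mag_face_subset)
  show "delete_at j (s @ r) \<in> late_lists (length r - 1)"
    using crosses_late_delete_at[OF assms(2-4)] subset_trans[OF set_delete_at_subset assms(1)]
    by (simp only: late_lists_def lists_eq_set mem_Collect_eq simp_thms)
qed

text \<open>
  Deleting the only point of \<open>s\<close> outside \<open>Z\<close> destroys the crossing at \<open>x\<close>, and the first crossing
  moves into \<open>t\<close> or disappears. Such faces are negligible in the filtration, with or without the gate.
\<close>

lemma face_before_crossing:
  assumes "first_crossing s x" "set (s @ x # t) \<subseteq> X" "1 \<le> j" "j < length s"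
    and gone: "\<forall>y\<in>set (delete_at j s). y \<in> Z"
  shows "Poly_Mapping.keys (mag_face d j (s @ x # t)) \<subseteq> late_lists (length t)"
    and "Poly_Mapping.keys (mag_face d j (s @ \<pi> x # x # t)) \<subseteq> late_lists (length t)"
proof -
  have x: "x \<in> X" and s: "set s \<subseteq> X" "set t \<subseteq> X" using assms(2) by auto
  note g = gate_of_crossing[OF assms(1) x]
  have ds: "set (delete_at j s) \<subseteq> X" using set_delete_at_subset[of j s] s by blast
  have nc: "\<not> crosses (delete_at j s @ [x])" "\<not> crosses (delete_at j s @ [\<pi> x, x])"
    using gone g(1,3) by (intro not_crosses_if_one_side disjI2; simp add: subset_iff)+
  show "Poly_Mapping.keys (mag_face d j (s @ x # t)) \<subseteq> late_lists (length t)"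
  proof (rule keys_mag_face_subset)
    have eq: "delete_at j (s @ x # t) = (delete_at j s @ [x]) @ t" using assms(4) by simp
    show "delete_at j (s @ x # t) \<in> late_lists (length t)"
      unfolding eq by (rule late_listsI[OF _ s(2) nc(1) order.refl]) (use ds x in simp)
  qed
  show "Poly_Mapping.keys (mag_face d j (s @ \<pi> x # x # t)) \<subseteq> late_lists (length t)"
  proof (rule keys_mag_face_subset)
    have eq: "delete_at j (s @ \<pi> x # x # t) = (delete_at j s @ [\<pi> x, x]) @ t"
      using assms(4) by simp
    show "delete_at j (s @ \<pi> x # x # t) \<in> late_lists (length t)"
      unfolding eq by (rule late_listsI[OF _ s(2) nc(2) order.refl]) (use ds x g in simp)
  qed
qed

lemma first_crossing_delete_at:
  assumes "first_crossing s x" "\<not> (\<forall>y\<in>set (delete_at j s). y \<in> Z)"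
  shows "first_crossing (delete_at j s) x"
  using assms crosses_delete_at unfolding first_crossing_def by blast

lemma mag_face_append:
  assumes "1 \<le> j" "Suc j < length s"
  shows "mag_face d j (s @ r) =
    (if metric_between d (s ! (j - 1)) (s ! j) (s ! Suc j) then frag_of (delete_at j s @ r) else 0)"
proof -
  have "j - 1 < length s" "j < length s" using assms by auto
  then show ?thesis using assms by (simp add: mag_face_def nth_append)
qed

lemma mag_face_append_last:
  "mag_face d (Suc (length u)) (u @ b # c # a # r) =
    (if metric_between d b c a then frag_of (u @ b # a # r) else 0)"
  by (simp add: mag_face_def nth_append)

text \<open>
  Deleting a point of \<open>s\<close> commutes with inserting the gate, except for faces that destroy the
  crossing. The delicate case is the deletion of the last point \<open>c\<close> of \<open>s\<close>, whose right neighbour is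
  \<open>x\<close> before the insertion and \<open>\<pi> x\<close> after it. As \<open>\<pi> x\<close> is between \<open>x\<close> and every point of \<open>Y\<close>, \<open>c\<close> is
  between its left neighbour \<open>b\<close> and \<open>x\<close> exactly if it is between \<open>b\<close> and \<open>\<pi> x\<close>.
\<close>

lemma gate_insertion_commutes_before:
  assumes fc: "first_crossing s x" and p: "set (s @ x # t) \<subseteq> X" "distinct_adj (s @ x # t)"
    and ne: "last s \<noteq> \<pi> x" and j: "1 \<le> j" "j < length s"
  shows "Poly_Mapping.keys (gate_homotopy (mag_face d j (s @ x # t)) +
      frag_cmul ((-1) ^ length s) (mag_face d j (s @ \<pi> x # x # t))) \<subseteq> late_lists (length t)"
proof (cases "\<forall>y\<in>set (delete_at j s). y \<in> Z")
  case True
  show ?thesis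
    by (intro keys_add_subset keys_cmul_subset keys_gate_homotopy_late
        face_before_crossing[OF fc p(1) j True])
next
  case False
  note fc' = first_crossing_delete_at[OF fc False]
  have x: "x \<in> X" and sX: "set s \<subseteq> X" using p by auto
  note g = gate_of_crossing[OF fc x]
  define D where "D = delete_at j s"
  have len: "length s = Suc (length D)" unfolding D_def using j by auto
  have "gate_homotopy (mag_face d j (s @ x # t)) =
      - frag_cmul ((-1) ^ length s) (mag_face d j (s @ \<pi> x # x # t))"
  proof (cases "Suc j < length s")
    case True
    have "drop (Suc j) s \<noteq> []" "last (drop (Suc j) s) = last s" using True by auto
    then have "last D \<noteq> \<pi> x" using ne by (simp add: D_def last_append)
    then show ?thesis
      using insert_gate_split[OF fc', of t] len
      unfolding mag_face_append[OF j(1) True] D_def[symmetric] by simp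
  next
    case False
    obtain s0 c where s0: "s = s0 @ [c]" using j by (cases s rule: rev_cases) auto
    obtain u b where "s0 = u @ [b]" using j s0 by (cases s0 rule: rev_cases) auto
    then have s: "s = u @ [b, c]" using s0 by simp
    have ju: "j = Suc (length u)" using False j s by simp
    have ds: "delete_at j s = u @ [b]" unfolding ju s by simp
    have "b \<in> Y" using last_in_if_first_crossing[OF fc'] set_delete_at_subset[of j s] sX ds by auto
    have "c \<in> Y" using last_in_if_first_crossing[OF fc sX] s by simp
    have gx: "d b x = d b (\<pi> x) + d (\<pi> x) x" "d c x = d c (\<pi> x) + d (\<pi> x) x"
      using gate_between \<open>b \<in> Y\<close> \<open>c \<in> Y\<close> g by blast+
    have btw: "metric_between d b c x \<longleftrightarrow> metric_between d b c (\<pi> x)"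
      using gx by (simp add: metric_between_def)
    \<comment> \<open>If \<open>b\<close> is the gate, insertion gives \<open>0\<close> after the deletion, and the other face is \<open>0\<close> as well.\<close>
    have degenerate: "\<not> metric_between d b c (\<pi> x)" if "b = \<pi> x"
    proof -
      have "c \<noteq> \<pi> x" "c \<in> X" using ne s sX by auto
      then have "0 < d c (\<pi> x)" "d (\<pi> x) (\<pi> x) = 0" using g by auto
      then show ?thesis
        using nonneg[of "\<pi> x" c] unfolding metric_between_def that by linarith
    qed
    have fcb: "first_crossing (u @ [b]) x" using fc' ds by simp
    have p': "s @ x # t = u @ b # c # x # t" "s @ \<pi> x # x # t = u @ b # c # \<pi> x # x # t"
      using s by simp_all
    have "insert_gate (u @ b # x # t) = (if b = \<pi> x then 0
        else frag_cmul ((-1) ^ Suc (length u)) (frag_of (u @ b # \<pi> x # x # t)))"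
      using insert_gate_split[OF fcb, of t] by simp
    then show ?thesis
      using btw degenerate unfolding p' ju mag_face_append_last by (auto simp: s)
  qed
  then show ?thesis by (simp only: add.left_inverse keys_zero empty_subsetI)
qed

text \<open>
  If \<open>s\<close> ends with the gate of \<open>x\<close>, then so does \<open>s\<close> after the deletion of an earlier point, and
  nothing is inserted unless the crossing is destroyed.
\<close>

lemma gate_deletion_before:
  assumes fc: "first_crossing s x" and p: "set (s @ x # t) \<subseteq> X" "distinct_adj (s @ x # t)"
    and eq: "last s = \<pi> x" and j: "1 \<le> j" "Suc j < length s"
  shows "Poly_Mapping.keys (gate_homotopy (mag_face d j (s @ x # t))) \<subseteq> late_lists (length t)"
proof (cases "\<forall>y\<in>set (delete_at j s). y \<in> Z")
  case True
  show ?thesis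
    by (intro keys_gate_homotopy_late face_before_crossing[OF fc p(1) j(1) _ True]) (use j in simp)
next
  case False
  note fc' = first_crossing_delete_at[OF fc False]
  have "drop (Suc j) s \<noteq> []" "last (drop (Suc j) s) = last s" using j by auto
  then have "last (delete_at j s) = \<pi> x" using eq by (simp add: last_append)
  then have "insert_gate (delete_at j s @ x # t) = 0" using insert_gate_split[OF fc', of t] by presburger
  then show ?thesis unfolding mag_face_append[OF j] by (simp del: append_assoc)
qed

text \<open>
  Deleting the gate in front of \<open>x\<close> is always admissible, and the homotopy puts it back.
\<close>

lemma gate_deletion_at:
  assumes fc: "first_crossing s x" and p: "set (s @ x # t) \<subseteq> X" "distinct_adj (s @ x # t)"
    and eq: "last s = \<pi> x"
  obtains j where "1 \<le> j" "length s = Suc j"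
    "gate_homotopy (mag_face d j (s @ x # t)) = frag_cmul ((-1) ^ j) (frag_of (s @ x # t))"
proof -
  have x: "x \<in> X" and sX: "set s \<subseteq> X" using p by auto
  note g = gate_of_crossing[OF fc x]
  obtain v where v: "s = v @ [\<pi> x]" using last_in_if_first_crossing(1)[OF fc sX] eq
    by (cases s rule: rev_cases) auto
  have fcv: "first_crossing v x" using fc g unfolding v by (auto simp: first_crossing_def crosses_append)
  then obtain u b where u: "v = u @ [b]" using last_in_if_first_crossing(1)[OF fcv] sX v
    by (cases v rule: rev_cases) auto
  have "b \<in> Y" using last_in_if_first_crossing(2)[OF fcv] sX u v by auto
  have "metric_between d b (\<pi> x) x" using gate_between[OF \<open>b \<in> Y\<close> g(1)] by (simp add: metric_between_def)
  moreover have "b \<noteq> \<pi> x" using p(2) unfolding v u by (auto simp: distinct_adj_append_iff)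
  moreover have "s @ x # t = u @ b # \<pi> x # x # t" unfolding v u by simp
  ultimately have "gate_homotopy (mag_face d (Suc (length u)) (s @ x # t)) =
      frag_cmul ((-1) ^ Suc (length u)) (frag_of (s @ x # t))"
    using insert_gate_split[OF fcv, of t] unfolding u by (simp add: mag_face_append_last)
  then show thesis using that[of "Suc (length u)"] u v by simp
qed

end

section \<open>Pushing chains to one side\<close>

context gate_projection
begin

lemma sign_square: "(-1 :: int) ^ n * (-1) ^ n = 1"
  by (simp flip: power_mult_distrib)

text \<open>
  Faces at or after the first crossing move the first crossing towards the end, and the homotopy
  preserves this. Among the earlier faces, exactly one returns \<open>p\<close>: it removes the gate
  of \<open>x\<close>, from \<open>p\<close> itself if \<open>p\<close> has the gate in front of \<open>x\<close>, and from the list with the gate inserted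
  otherwise. The remaining faces cancel, are sent to \<open>0\<close>, or destroy the crossing.
\<close>

lemma gate_homotopy_step_split:
  assumes fc: "first_crossing s x" and p: "s @ x # t \<in> mag_paths X k"
  shows "Poly_Mapping.keys (frag_of (s @ x # t) - mag_boundary d (Suc k) (insert_gate (s @ x # t))
      - gate_homotopy (mag_boundary d k (frag_of (s @ x # t)))) \<subseteq> late_lists (length t)"
proof -
  let ?p = "s @ x # t" and ?q = "s @ \<pi> x # x # t" and ?i = "length s"
  let ?L = "late_lists (length t)"
  have sub: "set ?p \<subseteq> X" and adj: "distinct_adj ?p" and k: "k = ?i + length t"
    using p by (auto simp: mag_paths_def)
  have x: "x \<in> X" and sX: "set s \<subseteq> X" using sub by auto
  note g = gate_of_crossing[OF fc x]
  have nc: "\<not> crosses s" "\<not> crosses (s @ [\<pi> x])"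
    using fc g by (simp_all add: first_crossing_def crosses_append)
  have i: "1 \<le> ?i" using last_in_if_first_crossing(1)[OF fc sX] by (cases s) auto
  let ?before = "\<lambda>j. gate_homotopy (mag_face d j ?p)"
  have faces: "gate_homotopy (mag_boundary d k (frag_of ?p)) =
      (\<Sum>j\<in>{1..<?i}. frag_cmul ((-1) ^ j) (?before j)) +
      (\<Sum>j\<in>{?i..<k}. frag_cmul ((-1) ^ j) (?before j))" (is "_ = ?B + ?A")
  proof -
    have "{1..<k} = {1..<?i} \<union> {?i..<k}" "{1..<?i} \<inter> {?i..<k} = {}" using i k by auto
    then show ?thesis
      unfolding mag_boundary_frag_of gate_homotopy_def
        frag_extend_sum_cmul[OF finite_atLeastLessThan]
      by (simp only: sum.union_disjoint[OF finite_atLeastLessThan finite_atLeastLessThan])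
  qed
  have after: "Poly_Mapping.keys ?A \<subseteq> ?L"
  proof (intro keys_sum_subset keys_cmul_subset keys_gate_homotopy_late)
    fix j assume "j \<in> {?i..<k}"
    then show "Poly_Mapping.keys (mag_face d j ?p) \<subseteq> ?L"
      using keys_mag_face_after[OF sub nc(1), of j] k by simp
  qed
  show ?thesis
  proof (cases "last s = \<pi> x")
    case True
    obtain j where j: "1 \<le> j" "?i = Suc j" "?before j = frag_cmul ((-1) ^ j) (frag_of ?p)"
      using gate_deletion_at[OF fc sub adj True] by metis
    let ?R = "\<Sum>n\<in>{1..<j}. frag_cmul ((-1) ^ n) (?before n)"
    have "{1..<?i} = insert j {1..<j}" using j by auto
    then have "?B = frag_cmul ((-1) ^ j) (?before j) + ?R" by simp
    also have "frag_cmul ((-1) ^ j) (?before j) = frag_of ?p"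
      unfolding j(3) by (simp only: frag_cmul_cmul sign_square frag_cmul_one)
    finally have "frag_of ?p - mag_boundary d (Suc k) (insert_gate ?p)
        - gate_homotopy (mag_boundary d k (frag_of ?p)) = - (?R + ?A)"
      unfolding faces insert_gate_split[OF fc] if_P[OF True] mag_boundary_simps(1)
      by (simp add: algebra_simps)
    moreover have "Poly_Mapping.keys (\<Sum>n\<in>{1..<j}. frag_cmul ((-1) ^ n) (?before n)) \<subseteq> ?L"
    proof (intro keys_sum_subset keys_cmul_subset)
      fix n assume "n \<in> {1..<j}"
      then show "Poly_Mapping.keys (?before n) \<subseteq> ?L"
        using gate_deletion_before[OF fc sub adj True, of n] j by simp
    qed
    ultimately show ?thesis
      using keys_add_subset[OF _ after] by (simp only: keys_minus)
  next
    case False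
    have regroup: "P - (F + P + G) - (B + A) = - (S + (G + A))" if "B + F = S"
      for P F G B A S :: "'a list \<Rightarrow>\<^sub>0 int"
      using that by (auto simp: algebra_simps)
    let ?f = "\<lambda>j. frag_cmul ((-1) ^ j) (mag_face d j ?q)"
    have qX: "set ((s @ [\<pi> x]) @ x # t) \<subseteq> X" using sub g by simp
    have "last s \<in> Y" using last_in_if_first_crossing(2)[OF fc sX] .
    then have "metric_between d (last s) (\<pi> x) x"
      using gate_between g(1) by (simp add: metric_between_def)
    moreover have "?q ! (?i - 1) = last s" "?q ! ?i = \<pi> x" "?q ! (?i + 1) = x"
      using i last_conv_nth[of s] last_in_if_first_crossing(1)[OF fc sX]
      by (simp_all add: nth_append)
    ultimately have "mag_face d ?i ?q = frag_of ?p"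
      unfolding mag_face_def by simp
    moreover have "{1..<Suc k} = {1..<?i} \<union> ({?i} \<union> {Suc ?i..<Suc k})"
      "{1..<?i} \<inter> ({?i} \<union> {Suc ?i..<Suc k}) = {}" using i k by auto
    ultimately have "mag_boundary d (Suc k) (frag_of ?q) =
        sum ?f {1..<?i} + (frag_cmul ((-1) ^ ?i) (frag_of ?p) + sum ?f {Suc ?i..<Suc k})"
      unfolding mag_boundary_frag_of by (simp add: sum.union_disjoint)
    then have "mag_boundary d (Suc k) (insert_gate ?p) =
        frag_cmul ((-1) ^ ?i) (sum ?f {1..<?i}) + frag_of ?p +
          frag_cmul ((-1) ^ ?i) (sum ?f {Suc ?i..<Suc k})"
      unfolding insert_gate_split[OF fc] if_not_P[OF False] mag_boundary_simps(5)
      by (simp only: frag_cmul_distrib2 add.assoc frag_cmul_cmul sign_square frag_cmul_one)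
    moreover have "?B + frag_cmul ((-1) ^ ?i) (sum ?f {1..<?i}) =
        (\<Sum>j\<in>{1..<?i}. frag_cmul ((-1) ^ j) (?before j + frag_cmul ((-1) ^ ?i) (mag_face d j ?q)))"
      by (simp only: frag_cmul_distrib2 frag_cmul_sum frag_cmul_cmul sum.distrib mult.commute)
    ultimately have eq: "frag_of ?p - mag_boundary d (Suc k) (insert_gate ?p)
        - gate_homotopy (mag_boundary d k (frag_of ?p)) =
       - ((\<Sum>j\<in>{1..<?i}. frag_cmul ((-1) ^ j) (?before j + frag_cmul ((-1) ^ ?i) (mag_face d j ?q)))
         + (frag_cmul ((-1) ^ ?i) (sum ?f {Suc ?i..<Suc k}) + ?A))"
      unfolding faces by (simp only: regroup)
    have "Poly_Mapping.keys (\<Sum>j\<in>{1..<?i}.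
        frag_cmul ((-1) ^ j) (?before j + frag_cmul ((-1) ^ ?i) (mag_face d j ?q))) \<subseteq> ?L"
    proof (intro keys_sum_subset keys_cmul_subset[where A = ?L])
      fix j assume "j \<in> {1..<?i}"
      then show "Poly_Mapping.keys (?before j + frag_cmul ((-1) ^ ?i) (mag_face d j ?q)) \<subseteq> ?L"
        using gate_insertion_commutes_before[OF fc sub adj False, of j] by simp
    qed
    moreover have "Poly_Mapping.keys (sum ?f {Suc ?i..<Suc k}) \<subseteq> ?L"
    proof (intro keys_sum_subset keys_cmul_subset)
      fix j assume "j \<in> {Suc ?i..<Suc k}"
      then show "Poly_Mapping.keys (mag_face d j ?q) \<subseteq> ?L"
        using keys_mag_face_after[OF qX nc(2), of j] k by simp
    qed
    ultimately show ?thesis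
      unfolding eq keys_minus using after by (intro keys_add_subset keys_cmul_subset)
  qed
qed

lemma gate_homotopy_step:
  assumes "Poly_Mapping.keys c \<subseteq> mag_paths X k \<inter> late_lists (Suc n)"
  shows "Poly_Mapping.keys (c - mag_boundary d (Suc k) (gate_homotopy c)
      - gate_homotopy (mag_boundary d k c)) \<subseteq> late_lists n"
  using assms
proof (induction c rule: frag_induction)
  case (one p)
  show ?case
  proof (cases "crosses p")
    case True
    then obtain s x t where p: "p = s @ x # t" and fc: "first_crossing s x"
      by (rule crosses_split)
    have "crosses_late (Suc n) (s @ x # t)" using one late_listsD(1) unfolding p by blast
    from crosses_late_split[OF this fc] have "length t \<le> n" by simp
    then have "late_lists (length t) \<subseteq> late_lists n"
      unfolding late_lists_def using crosses_late_mono by blast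
    then show ?thesis using gate_homotopy_step_split[OF fc, of t k] one
      unfolding p gate_homotopy_simps(2) by blast
  next
    case False
    have "gate_homotopy (mag_boundary d k (frag_of p)) = 0"
      unfolding gate_homotopy_def
    proof (rule frag_extend_eq_0)
      fix q assume "q \<in> Poly_Mapping.keys (mag_boundary d k (frag_of p))"
      moreover have "Poly_Mapping.keys (mag_boundary d k (frag_of p)) \<subseteq> {q. \<not> crosses q}"
      proof (rule keys_mag_boundary_subset)
        show "Poly_Mapping.keys (frag_of p) \<subseteq> {q. \<not> crosses q}" using False by simp
        show "Poly_Mapping.keys (mag_face d i q) \<subseteq> {q. \<not> crosses q}"
          if "q \<in> {q. \<not> crosses q}" for q i
          using that crosses_delete_at keys_mag_face by blast
      qed
      ultimately show "insert_gate q = 0" using insert_gate_not_crosses by blast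
    qed
    then show ?thesis
      using False one insert_gate_not_crosses not_crosses_late by (auto simp: late_lists_def)
  qed
next
  case (diff a b)
  let ?N = "\<lambda>c. c - mag_boundary d (Suc k) (gate_homotopy c) - gate_homotopy (mag_boundary d k c)"
  have "?N (a - b) = ?N a - ?N b" by simp
  then show ?case using keys_diff_subset[OF diff] by (simp only:)
qed simp

text \<open>
  Since \<open>\<partial>c\<close> has no crossings, \<open>h\<partial>c = 0\<close>, and replacing \<open>c\<close> by \<open>c - \<partial>hc\<close> improves the filtration degree
  while keeping the boundary. The predicate \<open>Q\<close> keeps a property through the process that survives
  the deletion of points and the insertion of gates; the absence of crossings in the opposite
  order is such a property.
\<close>

lemma push_off_crossings:
  assumes del: "\<And>u y v. Q (u @ y # v) \<Longrightarrow> Q (u @ v)"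
    and ins: "\<And>u g v. Q (u @ v) \<Longrightarrow> g \<in> Y \<inter> Z \<Longrightarrow> Q (u @ g # v)"
    and c: "Poly_Mapping.keys c \<subseteq> {p \<in> mag_paths X k. Q p}"
    and bdry: "Poly_Mapping.keys (mag_boundary d k c) \<subseteq> {p. \<not> crosses p}"
  obtains e where "Poly_Mapping.keys e \<subseteq> {p \<in> mag_paths X (Suc k). Q p}"
    "Poly_Mapping.keys (c - mag_boundary d (Suc k) e) \<subseteq> {p \<in> mag_paths X k. Q p \<and> \<not> crosses p}"
proof -
  have keys_bdry: "Poly_Mapping.keys (mag_boundary d (Suc k) e) \<subseteq> {p \<in> mag_paths X k. Q p}"
    if e: "Poly_Mapping.keys e \<subseteq> {p \<in> mag_paths X (Suc k). Q p}" for e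
  proof (rule keys_mag_boundary_subset[OF e])
    fix p i assume p: "p \<in> {p \<in> mag_paths X (Suc k). Q p}" and i: "1 \<le> i" "i < Suc k"
    have "i < length p" using p i by (simp add: mag_paths_def)
    moreover have "Q p" using p by simp
    ultimately have "Q (take i p @ p ! i # drop (Suc i) p)" by (simp only: id_take_nth_drop[symmetric])
    then have "Q (delete_at i p)" by (rule del)
    then show "Poly_Mapping.keys (mag_face d i p) \<subseteq> {p \<in> mag_paths X k. Q p}"
    proof (intro subsetI CollectI conjI)
      fix q assume q: "q \<in> Poly_Mapping.keys (mag_face d i p)"
      have "Poly_Mapping.keys (mag_face d i p) \<subseteq> mag_paths X k"
        using keys_mag_face_paths[of X p "Suc k" i] p i by simp
      then show "q \<in> mag_paths X k" using q by blast
      show "Q q" using keys_mag_face[OF q] \<open>Q (delete_at i p)\<close> by simp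
    qed
  qed
  have "\<exists>e. Poly_Mapping.keys e \<subseteq> {p \<in> mag_paths X (Suc k). Q p} \<and>
    Poly_Mapping.keys (c - mag_boundary d (Suc k) e) \<subseteq> {p \<in> mag_paths X k. Q p \<and> \<not> crosses p}"
    if "Poly_Mapping.keys c \<subseteq> late_lists n" for n
    using that c bdry
  proof (induction n arbitrary: c)
    case 0
    then show ?case
      unfolding late_lists_def crosses_late_0
      by (intro exI[of _ 0] conjI) (simp, simp only: mag_boundary_simps(1) diff_zero, blast)
  next
    case (Suc n)
    let ?e = "gate_homotopy c" and ?c = "c - mag_boundary d (Suc k) (gate_homotopy c)"
    have e: "Poly_Mapping.keys ?e \<subseteq> {p \<in> mag_paths X (Suc k). Q p}"
      unfolding gate_homotopy_def
    proof (rule keys_frag_extend_subset[OF Suc.prems(2)], intro subsetI CollectI conjI)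
      fix p q assume p: "p \<in> {p \<in> mag_paths X k. Q p}" and q: "q \<in> Poly_Mapping.keys (insert_gate p)"
      then show "q \<in> mag_paths X (Suc k)" using keys_insert_gate_paths by blast
      from q obtain s x t where sxt: "p = s @ x # t" "first_crossing s x" "q = s @ \<pi> x # x # t"
        by (rule keys_insert_gate_cases)
      have "x \<in> X" using p sxt by (simp add: mag_paths_def)
      then show "Q q" using ins[of s "x # t" "\<pi> x"] gate_of_crossing[OF sxt(2)] p sxt by simp
    qed
    have z: "gate_homotopy (mag_boundary d k c) = 0"
      unfolding gate_homotopy_def
      by (rule frag_extend_eq_0) (use Suc.prems(3) insert_gate_not_crosses in blast)
    have late: "Poly_Mapping.keys ?c \<subseteq> late_lists n"
      using gate_homotopy_step[of c k n] Suc.prems(1,2) unfolding z diff_zero by blast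
    have c': "Poly_Mapping.keys ?c \<subseteq> {p \<in> mag_paths X k. Q p}"
      by (rule keys_diff_subset[OF Suc.prems(2) keys_bdry[OF e]])
    have "mag_boundary d k (mag_boundary d (Suc k) ?e) = 0"
      using mag_boundary_boundary[of ?e "Suc k"] e unfolding diff_Suc_1 by blast
    then have "Poly_Mapping.keys (mag_boundary d k ?c) \<subseteq> {p. \<not> crosses p}"
      using Suc.prems(3) by (simp only: mag_boundary_simps(3) diff_zero)
    then obtain e' where e': "Poly_Mapping.keys e' \<subseteq> {p \<in> mag_paths X (Suc k). Q p}"
      "Poly_Mapping.keys (?c - mag_boundary d (Suc k) e') \<subseteq> {p \<in> mag_paths X k. Q p \<and> \<not> crosses p}"
      using Suc.IH[OF late c'] by blast
    have "c - mag_boundary d (Suc k) (?e + e') = ?c - mag_boundary d (Suc k) e'"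
      by (simp add: algebra_simps)
    then show ?case
      using e'(2) keys_add_subset[OF e e'(1)] by (intro exI[of _ "?e + e'"] conjI) (simp_all only:)
  qed
  moreover have "Poly_Mapping.keys c \<subseteq> late_lists (Suc k)"
    using c crosses_late_all by (auto simp: late_lists_def mag_paths_def)
  ultimately show thesis using that by blast
qed

end

definition reverse_chain :: "('a list \<Rightarrow>\<^sub>0 int) \<Rightarrow> 'a list \<Rightarrow>\<^sub>0 int" where
  "reverse_chain = frag_extend (\<lambda>p. frag_of (rev p))"

lemma reverse_chain_simps [simp]:
  "reverse_chain 0 = 0"
  "reverse_chain (frag_of p) = frag_of (rev p)"
  "reverse_chain (a + b) = reverse_chain a + reverse_chain b"
  "reverse_chain (a - b) = reverse_chain a - reverse_chain b"
  "reverse_chain (frag_cmul n a) = frag_cmul n (reverse_chain a)"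
  by (simp_all add: reverse_chain_def frag_extend_add frag_extend_diff frag_extend_cmul)

lemma reverse_chain_reverse_chain [simp]: "reverse_chain (reverse_chain c) = c"
  using subset_UNIV by (induction c rule: frag_induction) simp_all

lemma keys_reverse_chain:
  assumes "Poly_Mapping.keys c \<subseteq> A" "\<And>p. p \<in> A \<Longrightarrow> rev p \<in> B"
  shows "Poly_Mapping.keys (reverse_chain c) \<subseteq> B"
  unfolding reverse_chain_def by (rule keys_frag_extend_subset[OF assms(1)]) (use assms(2) in auto)

lemma rev_mag_paths: "rev p \<in> mag_paths A k \<longleftrightarrow> p \<in> mag_paths A k"
  by (simp add: mag_paths_def)

lemma (in Metric_space) mag_face_rev:
  assumes "length p = Suc k" "1 \<le> i" "i < k"
  shows "mag_face d i (rev p) = reverse_chain (mag_face d (k - i) p)"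
proof -
  have "rev p ! (i - 1) = p ! (k - i + 1)" "rev p ! i = p ! (k - i)" "rev p ! (i + 1) = p ! (k - i - 1)"
    using assms by (simp_all add: rev_nth Suc_diff_le)
  moreover have "metric_between d x y z \<longleftrightarrow> metric_between d z y x" for x y z
    unfolding metric_between_def using commute[of x y] commute[of y z] commute[of x z]
    by linarith
  moreover have "delete_at i (rev p) = rev (delete_at (k - i) p)"
    using assms by (simp add: take_rev drop_rev Suc_diff_le)
  ultimately show ?thesis by (simp add: mag_face_def)
qed

lemma (in Metric_space) mag_boundary_reverse_chain:
  assumes "Poly_Mapping.keys c \<subseteq> {p. length p = Suc k}"
  shows "mag_boundary d k (reverse_chain c) =
    frag_cmul ((-1) ^ k) (reverse_chain (mag_boundary d k c))"
  using assms
proof (induction c rule: frag_induction)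
  case (one p)
  have "mag_boundary d k (reverse_chain (frag_of p)) =
      (\<Sum>i\<in>{1..<k}. frag_cmul ((-1) ^ i) (reverse_chain (mag_face d (k - i) p)))"
    using one by (simp add: mag_boundary_frag_of mag_face_rev)
  also have "\<dots> = (\<Sum>i\<in>{1..<k}. frag_cmul ((-1) ^ (k + i)) (reverse_chain (mag_face d i p)))"
  proof (rule sum.reindex_bij_witness[of _ "\<lambda>i. k - i" "\<lambda>i. k - i"])
    fix i assume "i \<in> {1..<k}"
    then have "i \<le> k" by simp
    then have "k + (k - i) = 2 * (k - i) + i" by simp
    then have "(-1 :: int) ^ (k + (k - i)) = (-1) ^ i" by (simp only: power_add) simp
    then show "frag_cmul ((-1) ^ (k + (k - i))) (reverse_chain (mag_face d (k - i) p)) =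
        frag_cmul ((-1) ^ i) (reverse_chain (mag_face d (k - i) p))" by simp
  qed auto
  also have "\<dots> = frag_cmul ((-1) ^ k) (reverse_chain (mag_boundary d k (frag_of p)))"
    by (simp add: mag_boundary_frag_of reverse_chain_def frag_extend_sum_cmul frag_cmul_sum power_add)
  finally show ?case .
qed (simp_all add: frag_cmul_diff)

text \<open>
  Crossings in the given order are removed first, and those in the opposite order by applying the
  same argument to the reversed paths. By the choice of \<open>Q\<close> the second round creates no crossings of the
  kind that the first one removed. Reversal is compatible with boundaries up to the sign
  \<open>(- 1) ^ k\<close>.
\<close>

lemma (in gate_projection) push_to_one_side:
  assumes c: "Poly_Mapping.keys c \<subseteq> mag_paths X k"
    and bdry: "Poly_Mapping.keys (mag_boundary d k c) \<subseteq> lists Y \<union> lists Z"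
  obtains e where "Poly_Mapping.keys e \<subseteq> mag_paths X (Suc k)"
    "Poly_Mapping.keys (c - mag_boundary d (Suc k) e) \<subseteq> mag_paths Y k \<union> mag_paths Z k"
proof -
  have sides: "lists Y \<union> lists Z \<subseteq> {p. \<not> crosses p}"
    using not_crosses_if_one_side by (auto simp: lists_eq_set)
  obtain e where e: "Poly_Mapping.keys e \<subseteq> mag_paths X (Suc k)"
    "Poly_Mapping.keys (c - mag_boundary d (Suc k) e) \<subseteq> {p \<in> mag_paths X k. \<not> crosses p}"
    by (rule push_off_crossings[of "\<lambda>_. True" c k]) (use c subset_trans[OF bdry sides] in auto)
  let ?c = "c - mag_boundary d (Suc k) e"
  let ?Q = "\<lambda>p. \<not> crosses (rev p)"
  have bc: "mag_boundary d k ?c = mag_boundary d k c"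
    using mag_boundary_boundary[of e "Suc k"] e(1) by simp
  have len: "Poly_Mapping.keys ?c \<subseteq> {p. length p = Suc k}"
    using e(2) by (auto simp: mag_paths_def)
  have rc: "Poly_Mapping.keys (reverse_chain ?c) \<subseteq> {p \<in> mag_paths X k. ?Q p}"
    by (rule keys_reverse_chain[OF e(2)]) (simp add: rev_mag_paths)
  have rb: "Poly_Mapping.keys (mag_boundary d k (reverse_chain ?c)) \<subseteq> {p. \<not> crosses p}"
    unfolding mag_boundary_reverse_chain[OF len] bc
    by (intro keys_cmul_subset keys_reverse_chain[OF bdry])
       (use sides in \<open>auto simp: lists_eq_set intro!: not_crosses_if_one_side\<close>)
  obtain e' where e': "Poly_Mapping.keys e' \<subseteq> {p \<in> mag_paths X (Suc k). ?Q p}"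
    "Poly_Mapping.keys (reverse_chain ?c - mag_boundary d (Suc k) e')
       \<subseteq> {p \<in> mag_paths X k. ?Q p \<and> \<not> crosses p}"
    by (rule push_off_crossings[OF _ _ rc rb]) (auto simp: crosses_append)
  have len': "Poly_Mapping.keys e' \<subseteq> {p. length p = Suc (Suc k)}"
    using e'(1) by (auto simp: mag_paths_def)
  let ?e = "frag_cmul ((-1) ^ Suc k) (reverse_chain e')"
  have "reverse_chain (mag_boundary d (Suc k) e') = mag_boundary d (Suc k) ?e"
    unfolding mag_boundary_simps(5) mag_boundary_reverse_chain[OF len']
    by (simp only: frag_cmul_cmul sign_square frag_cmul_one)
  then have eq: "c - mag_boundary d (Suc k) (e + ?e) =
      reverse_chain (reverse_chain ?c - mag_boundary d (Suc k) e')"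
    by (simp add: algebra_simps)
  have "Poly_Mapping.keys (e + ?e) \<subseteq> mag_paths X (Suc k)"
    by (intro keys_add_subset keys_cmul_subset e(1) keys_reverse_chain[OF e'(1)])
       (simp add: rev_mag_paths)
  moreover have "Poly_Mapping.keys (c - mag_boundary d (Suc k) (e + ?e)) \<subseteq> mag_paths Y k \<union> mag_paths Z k"
    unfolding eq
  proof (rule keys_reverse_chain[OF e'(2)])
    fix p assume "p \<in> {p \<in> mag_paths X k. ?Q p \<and> \<not> crosses p}"
    then show "rev p \<in> mag_paths Y k \<union> mag_paths Z k"
      using one_side_if_not_crosses[of p] by (auto simp: mag_paths_def)
  qed
  ultimately show thesis using that by blast
qed

section \<open>Homology classes\<close>

definition mag_cycles :: "('a \<Rightarrow> 'a \<Rightarrow> real) \<Rightarrow> 'a set \<Rightarrow> nat \<Rightarrow> ('a list \<Rightarrow>\<^sub>0 int) set" where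
  "mag_cycles d A k = {c. Poly_Mapping.keys c \<subseteq> mag_paths A k \<and> mag_boundary d k c = 0}"

definition mag_class ::
    "('a \<Rightarrow> 'a \<Rightarrow> real) \<Rightarrow> 'a set \<Rightarrow> nat \<Rightarrow> ('a list \<Rightarrow>\<^sub>0 int) \<Rightarrow> ('a list \<Rightarrow>\<^sub>0 int) set" where
  "mag_class d A k c = mag_boundaries d A k #>\<^bsub>mag_cycle_group d A k\<^esub> c"

lemma mag_cycles_closed:
  "0 \<in> mag_cycles d A k"
  "a \<in> mag_cycles d A k \<Longrightarrow> b \<in> mag_cycles d A k \<Longrightarrow> a + b \<in> mag_cycles d A k"
  "a \<in> mag_cycles d A k \<Longrightarrow> b \<in> mag_cycles d A k \<Longrightarrow> a - b \<in> mag_cycles d A k"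
  "a \<in> mag_cycles d A k \<Longrightarrow> - a \<in> mag_cycles d A k"
  by (simp_all add: mag_cycles_def keys_add_subset keys_diff_subset)

lemma mag_cycles_mono: "A \<subseteq> B \<Longrightarrow> mag_cycles d A k \<subseteq> mag_cycles d B k"
  unfolding mag_cycles_def mag_paths_def by blast

lemma mag_boundariesI:
  "Poly_Mapping.keys e \<subseteq> mag_paths A (Suc k) \<Longrightarrow> mag_boundary d (Suc k) e \<in> mag_boundaries d A k"
  by (simp add: mag_boundaries_def mag_chain_group_def)

lemma mag_boundariesE:
  assumes "b \<in> mag_boundaries d A k"
  obtains e where "Poly_Mapping.keys e \<subseteq> mag_paths A (Suc k)" "b = mag_boundary d (Suc k) e"
  using assms by (auto simp: mag_boundaries_def mag_chain_group_def)

lemma mag_boundaries_uminus: "b \<in> mag_boundaries d A k \<Longrightarrow> - b \<in> mag_boundaries d A k"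
  using mag_boundaries_diff[OF zero_in_mag_boundaries] by fastforce

lemma mag_class_eq_iff:
  "mag_class d A k a = mag_class d A k b \<longleftrightarrow> a - b \<in> mag_boundaries d A k"
proof
  assume "mag_class d A k a = mag_class d A k b"
  moreover have "a \<in> mag_class d A k a"
    unfolding mag_class_def r_coset_mag_cycle_group
    by (rule image_eqI[OF _ zero_in_mag_boundaries]) simp
  ultimately show "a - b \<in> mag_boundaries d A k"
    by (auto simp: mag_class_def r_coset_mag_cycle_group)
next
  have "mag_class d A k a \<subseteq> mag_class d A k b" if ab: "a - b \<in> mag_boundaries d A k" for a b
    unfolding mag_class_def r_coset_mag_cycle_group
  proof (rule image_subsetI)
    fix h assume "h \<in> mag_boundaries d A k"
    from mag_boundaries_add[OF this ab] have "h + (a - b) \<in> mag_boundaries d A k" .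
    then show "h + a \<in> (\<lambda>h. h + b) ` mag_boundaries d A k"
      by (rule rev_image_eqI) simp
  qed
  moreover assume "a - b \<in> mag_boundaries d A k"
  moreover from this have "b - a \<in> mag_boundaries d A k"
    using mag_boundaries_uminus by fastforce
  ultimately show "mag_class d A k a = mag_class d A k b" by blast
qed

lemma mag_incl_class: "A \<subseteq> B \<Longrightarrow> mag_incl d k A B (mag_class d A k c) = mag_class d B k c"
  unfolding mag_class_def by (rule mag_incl_coset)

lemma carrier_mag_cycle_group: "carrier (mag_cycle_group d A k) = mag_cycles d A k"
proof -
  let ?G = "mag_chain_group A k"
  interpret G: group ?G by (simp add: mag_chain_group_def)
  have eq: "{c \<in> carrier ?G. mag_boundary d k c = 0} = mag_cycles d A k"
    by (auto simp: mag_cycles_def mag_chain_group_def)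
  have "subgroup (mag_cycles d A k) ?G"
  proof (rule G.subgroupI)
    show "mag_cycles d A k \<subseteq> carrier ?G" using eq by blast
    show "mag_cycles d A k \<noteq> {}" using mag_cycles_closed(1) by blast
    fix a assume a: "a \<in> mag_cycles d A k"
    then show "inv\<^bsub>?G\<^esub> a \<in> mag_cycles d A k"
      using mag_cycles_closed(4)[OF a] by (simp add: mag_chain_group_def mag_cycles_def)
    fix b assume "b \<in> mag_cycles d A k"
    then show "a \<otimes>\<^bsub>?G\<^esub> b \<in> mag_cycles d A k"
      using mag_cycles_closed(2)[OF a] by (simp add: mag_chain_group_def)
  qed
  then show ?thesis
    unfolding mag_cycle_group_def eq by (rule subgroup.carrier_subgroup_generated_subgroup)
qed

lemma mult_mag_cycle_group: "a \<otimes>\<^bsub>mag_cycle_group d A k\<^esub> b = a + b"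
  by (simp add: mag_cycle_group_def mag_chain_group_def)

lemma one_mag_cycle_group: "\<one>\<^bsub>mag_cycle_group d A k\<^esub> = 0"
  by (simp add: mag_cycle_group_def mag_chain_group_def)

lemma comm_group_mag_cycle_group: "comm_group (mag_cycle_group d A k)"
proof (rule comm_groupI)
  fix a assume "a \<in> carrier (mag_cycle_group d A k)"
  then show "\<exists>b\<in>carrier (mag_cycle_group d A k). b \<otimes>\<^bsub>mag_cycle_group d A k\<^esub> a = \<one>\<^bsub>mag_cycle_group d A k\<^esub>"
    unfolding carrier_mag_cycle_group mult_mag_cycle_group one_mag_cycle_group
    by (intro bexI[of _ "- a"]) (simp_all add: mag_cycles_closed)
qed (simp_all add: carrier_mag_cycle_group mult_mag_cycle_group one_mag_cycle_group
      mag_cycles_closed add.assoc add.commute)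

context Metric_space
begin

lemma mag_boundaries_subset_cycles:
  assumes "A \<subseteq> M" shows "mag_boundaries d A k \<subseteq> mag_cycles d A k"
proof
  fix b assume "b \<in> mag_boundaries d A k"
  then obtain e where e: "Poly_Mapping.keys e \<subseteq> mag_paths A (Suc k)" "b = mag_boundary d (Suc k) e"
    by (rule mag_boundariesE)
  have "Poly_Mapping.keys e \<subseteq> mag_paths M (Suc k)"
    using e(1) assms unfolding mag_paths_def by blast
  then show "b \<in> mag_cycles d A k"
    using keys_mag_boundary_paths[OF assms e(1)] mag_boundary_boundary[of e "Suc k"] e(2)
    by (simp add: mag_cycles_def)
qed

lemma normal_mag_boundaries:
  assumes "A \<subseteq> M" shows "mag_boundaries d A k \<lhd> mag_cycle_group d A k"
proof -
  interpret comm_group "mag_cycle_group d A k" by (rule comm_group_mag_cycle_group)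
  have "subgroup (mag_boundaries d A k) (mag_cycle_group d A k)"
  proof (rule subgroupI)
    show "mag_boundaries d A k \<subseteq> carrier (mag_cycle_group d A k)"
      using mag_boundaries_subset_cycles[OF assms] by (simp add: carrier_mag_cycle_group)
    show "mag_boundaries d A k \<noteq> {}" using zero_in_mag_boundaries by blast
    fix a assume a: "a \<in> mag_boundaries d A k"
    then have c: "a \<in> mag_cycles d A k" using mag_boundaries_subset_cycles[OF assms] by blast
    have "inv\<^bsub>mag_cycle_group d A k\<^esub> a = - a"
      by (rule inv_equality)
         (simp_all add: carrier_mag_cycle_group mult_mag_cycle_group one_mag_cycle_group
            mag_cycles_closed c)
    then show "inv\<^bsub>mag_cycle_group d A k\<^esub> a \<in> mag_boundaries d A k"
      using mag_boundaries_uminus[OF a] by simp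
    fix b assume "b \<in> mag_boundaries d A k"
    then show "a \<otimes>\<^bsub>mag_cycle_group d A k\<^esub> b \<in> mag_boundaries d A k"
      using mag_boundaries_add[OF a] by (simp add: mult_mag_cycle_group)
  qed
  then show ?thesis by (simp add: normal_iff_subgroup)
qed

lemma group_mag_homology: "A \<subseteq> M \<Longrightarrow> group (mag_homology d A k)"
  unfolding mag_homology_def by (rule normal.factorgroup_is_group[OF normal_mag_boundaries])

lemma carrier_mag_homology: "carrier (mag_homology d A k) = mag_class d A k ` mag_cycles d A k"
  unfolding mag_homology_def carrier_FactGroup carrier_mag_cycle_group mag_class_def ..

lemma one_mag_homology: "\<one>\<^bsub>mag_homology d A k\<^esub> = mag_class d A k 0"
  unfolding mag_homology_def one_FactGroup mag_class_def r_coset_mag_cycle_group by simp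

lemma mult_mag_homology:
  assumes "A \<subseteq> M" "a \<in> mag_cycles d A k" "b \<in> mag_cycles d A k"
  shows "mag_class d A k a \<otimes>\<^bsub>mag_homology d A k\<^esub> mag_class d A k b = mag_class d A k (a + b)"
  using normal.rcos_sum[OF normal_mag_boundaries[OF assms(1)], of a k b] assms(2,3)
  by (simp add: mag_homology_def mag_class_def carrier_mag_cycle_group mult_mag_cycle_group)

lemma inv_mag_homology:
  assumes "A \<subseteq> M" "a \<in> mag_cycles d A k"
  shows "inv\<^bsub>mag_homology d A k\<^esub> mag_class d A k a = mag_class d A k (- a)"
proof -
  interpret group "mag_homology d A k" using assms(1) by (rule group_mag_homology)
  show ?thesis
    by (rule inv_equality)
       (use assms mag_cycles_closed(4)[OF assms(2)]
         in \<open>simp_all add: carrier_mag_homology mult_mag_homology one_mag_homology\<close>)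
qed

end

section \<open>The Mayer--Vietoris sequence\<close>

context gate_projection
begin

lemma subspaces: "Y \<subseteq> X" "Z \<subseteq> X" "Y \<inter> Z \<subseteq> X" "Y \<inter> Z \<subseteq> Y" "Y \<inter> Z \<subseteq> Z"
  using cover by auto

lemma mag_paths_in_lists: "mag_paths A k \<subseteq> lists A"
  by (auto simp: mag_paths_def)

text \<open>
  Apply the retraction to a chain of \<open>Z\<close> with boundary \<open>c\<close>.
\<close>

lemma boundary_in_gates:
  assumes c: "c \<in> mag_cycles d (Y \<inter> Z) k" and b: "c \<in> mag_boundaries d Z k"
  shows "c \<in> mag_boundaries d (Y \<inter> Z) k"
proof -
  obtain e where e: "Poly_Mapping.keys e \<subseteq> mag_paths Z (Suc k)" "c = mag_boundary d (Suc k) e"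
    using b by (rule mag_boundariesE)
  have "Poly_Mapping.keys c \<subseteq> lists (Y \<inter> Z)"
    using c mag_paths_in_lists[of "Y \<inter> Z" k] unfolding mag_cycles_def by blast
  then have "c = retract c" by (rule retract_fixes[symmetric])
  also have "\<dots> = mag_boundary d (Suc k) (retract e)"
    unfolding e(2) by (rule retract_boundary[OF e(1)])
  finally show ?thesis using mag_boundariesI[OF keys_retract[OF e(1)]] by (rule ssubst)
qed

text \<open>
  Write the cycle as \<open>a + b\<close>, up to a boundary, with \<open>a\<close> in \<open>Y\<close> and \<open>b\<close> in \<open>Z\<close>. The summands need not be
  cycles, but \<open>\<partial>a = - \<partial>b\<close> lies in \<open>Y \<inter> Z\<close> and is unchanged by the retraction. So the retraction \<open>w\<close> of
  \<open>b\<close> has the same boundary as \<open>b\<close>, and \<open>a + w\<close> and \<open>b - w\<close> are cycles.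
\<close>

lemma cycle_splits:
  assumes c: "c \<in> mag_cycles d X k"
  obtains u v where "u \<in> mag_cycles d Y k" "v \<in> mag_cycles d Z k" "c - (u + v) \<in> mag_boundaries d X k"
proof -
  have cX: "Poly_Mapping.keys c \<subseteq> mag_paths X k" and "mag_boundary d k c = 0"
    using c by (simp_all add: mag_cycles_def)
  then obtain e where e: "Poly_Mapping.keys e \<subseteq> mag_paths X (Suc k)"
    "Poly_Mapping.keys (c - mag_boundary d (Suc k) e) \<subseteq> mag_paths Y k \<union> mag_paths Z k"
    by (metis push_to_one_side keys_zero empty_subsetI)
  obtain a b where ab: "Poly_Mapping.keys a \<subseteq> mag_paths Y k" "Poly_Mapping.keys b \<subseteq> mag_paths Z k"
    "a + b = c - mag_boundary d (Suc k) e"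
    using frag_split[OF e(2)] by metis
  have "c - mag_boundary d (Suc k) e \<in> mag_cycles d X k"
    using mag_cycles_closed(3)[OF c] mag_boundaries_subset_cycles[of X k] mag_boundariesI[OF e(1)] by blast
  then have sum0: "mag_boundary d k a + mag_boundary d k b = 0"
    unfolding ab(3)[symmetric] by (simp add: mag_cycles_def)
  then have ba: "mag_boundary d k a = - mag_boundary d k b"
    by (simp add: eq_neg_iff_add_eq_0)
  let ?w = "retract b"
  have wk: "Poly_Mapping.keys ?w \<subseteq> mag_paths (Y \<inter> Z) k" by (rule keys_retract[OF ab(2)])
  have "Poly_Mapping.keys (mag_boundary d k b) \<subseteq> lists Z"
    using keys_mag_boundary_paths[OF subspaces(2) ab(2)] mag_paths_in_lists by blast
  moreover have "Poly_Mapping.keys (mag_boundary d k b) \<subseteq> lists Y"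
    using keys_mag_boundary_paths[OF subspaces(1) ab(1)] mag_paths_in_lists
    unfolding ba keys_minus by blast
  ultimately have "Poly_Mapping.keys (mag_boundary d k b) \<subseteq> lists (Y \<inter> Z)"
    unfolding lists_Int_eq by (rule Int_greatest[rotated])
  then have bw: "mag_boundary d k ?w = mag_boundary d k b"
    using retract_boundary[OF ab(2)] retract_fixes by simp
  have wY: "Poly_Mapping.keys ?w \<subseteq> mag_paths Y k" and wZ: "Poly_Mapping.keys ?w \<subseteq> mag_paths Z k"
    using wk unfolding mag_paths_def by blast+
  have "a + ?w \<in> mag_cycles d Y k" "b - ?w \<in> mag_cycles d Z k"
    using ba bw keys_add_subset[OF ab(1) wY] keys_diff_subset[OF ab(2) wZ]
    by (simp_all add: mag_cycles_def)
  moreover have "c - ((a + ?w) + (b - ?w)) = mag_boundary d (Suc k) e"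
    using ab(3) by (simp add: algebra_simps)
  ultimately show thesis using that mag_boundariesI[OF e(1)] by metis
qed

text \<open>
  If \<open>u + v = \<partial>x\<close>, then \<open>x\<close> may be replaced by \<open>y + z\<close> with \<open>y\<close> in \<open>Y\<close> and \<open>z\<close> in \<open>Z\<close>. The cycle
  \<open>u - \<partial>y = \<partial>z - v\<close> belongs to both sides.
\<close>

lemma boundary_splits:
  assumes u: "u \<in> mag_cycles d Y k" and v: "v \<in> mag_cycles d Z k"
    and b: "u + v \<in> mag_boundaries d X k"
  obtains w where "w \<in> mag_cycles d (Y \<inter> Z) k" "u - w \<in> mag_boundaries d Y k"
    "v + w \<in> mag_boundaries d Z k"
proof -
  obtain x where x: "Poly_Mapping.keys x \<subseteq> mag_paths X (Suc k)" "u + v = mag_boundary d (Suc k) x"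
    using b by (rule mag_boundariesE)
  have "Poly_Mapping.keys (mag_boundary d (Suc k) x) \<subseteq> lists Y \<union> lists Z"
    unfolding x(2)[symmetric]
  proof (rule keys_add_subset)
    show "Poly_Mapping.keys u \<subseteq> lists Y \<union> lists Z" "Poly_Mapping.keys v \<subseteq> lists Y \<union> lists Z"
      using u v mag_paths_in_lists unfolding mag_cycles_def by blast+
  qed
  then obtain e where e: "Poly_Mapping.keys e \<subseteq> mag_paths X (Suc (Suc k))"
    "Poly_Mapping.keys (x - mag_boundary d (Suc (Suc k)) e) \<subseteq> mag_paths Y (Suc k) \<union> mag_paths Z (Suc k)"
    using push_to_one_side[OF x(1)] by blast
  obtain y z where yz: "Poly_Mapping.keys y \<subseteq> mag_paths Y (Suc k)"
    "Poly_Mapping.keys z \<subseteq> mag_paths Z (Suc k)" "y + z = x - mag_boundary d (Suc (Suc k)) e"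
    using frag_split[OF e(2)] by metis
  have "mag_boundary d (Suc k) (mag_boundary d (Suc (Suc k)) e) = 0"
    using mag_boundary_boundary[of e "Suc (Suc k)"] e(1) by simp
  then have uv: "u + v = mag_boundary d (Suc k) y + mag_boundary d (Suc k) z"
    unfolding x(2) using arg_cong[OF yz(3), of "mag_boundary d (Suc k)"] by simp
  let ?w = "u - mag_boundary d (Suc k) y"
  have w: "?w = mag_boundary d (Suc k) z - v"
    using uv by (simp add: algebra_simps)
  have y: "mag_boundary d (Suc k) y \<in> mag_boundaries d Y k"
    and z: "mag_boundary d (Suc k) z \<in> mag_boundaries d Z k"
    using yz by (auto intro: mag_boundariesI)
  have "?w \<in> mag_cycles d Y k"
    using mag_cycles_closed(3)[OF u] mag_boundaries_subset_cycles[OF subspaces(1)] y by blast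
  moreover have "?w \<in> mag_cycles d Z k"
    unfolding w using mag_cycles_closed(3)[OF _ v] mag_boundaries_subset_cycles[OF subspaces(2)] z by blast
  moreover have "mag_paths Y k \<inter> mag_paths Z k = mag_paths (Y \<inter> Z) k"
    unfolding mag_paths_def by blast
  ultimately have "?w \<in> mag_cycles d (Y \<inter> Z) k"
    unfolding mag_cycles_def by blast
  moreover have "u - ?w \<in> mag_boundaries d Y k" using y by simp
  moreover have "v + ?w \<in> mag_boundaries d Z k" unfolding w using z by simp
  ultimately show thesis by (rule that)
qed

lemma mayer_vietoris_short_exact:
  "short_exact
     (mag_homology d (Y \<inter> Z) k)
     (mag_homology d Y k \<times>\<times> mag_homology d Z k)
     (mag_homology d X k)
     (\<lambda>c. (mag_incl d k (Y \<inter> Z) Y c, inv\<^bsub>mag_homology d Z k\<^esub> (mag_incl d k (Y \<inter> Z) Z c)))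
     (\<lambda>(u, v). mag_incl d k Y X u \<otimes>\<^bsub>mag_homology d X k\<^esub> mag_incl d k Z X v)"
  (is "short_exact ?A (?B \<times>\<times> ?C) ?D ?f ?g")
proof -
  let ?W = "Y \<inter> Z"
  note hom_simps = carrier_mag_homology mult_mag_homology one_mag_homology inv_mag_homology
    mag_incl_class subspaces mag_cycles_closed
  have WY: "c \<in> mag_cycles d Y k" "c \<in> mag_cycles d Z k" if "c \<in> mag_cycles d ?W k" for c
    using that mag_cycles_mono[of ?W] by auto
  have YX: "c \<in> mag_cycles d X k" if "c \<in> mag_cycles d Y k \<or> c \<in> mag_cycles d Z k" for c
    using that mag_cycles_mono[OF subspaces(1)] mag_cycles_mono[OF subspaces(2)] by blast
  have f: "?f (mag_class d ?W k c) = (mag_class d Y k c, mag_class d Z k (- c))"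
    if "c \<in> mag_cycles d ?W k" for c
    using WY[OF that] by (simp add: hom_simps)
  have g: "?g (mag_class d Y k u, mag_class d Z k v) = mag_class d X k (u + v)"
    if "u \<in> mag_cycles d Y k" "v \<in> mag_cycles d Z k" for u v
    using YX that by (simp add: hom_simps)
  have groups: "group ?A" "group ?B" "group ?C" "group ?D" "group (?B \<times>\<times> ?C)"
    by (simp_all add: group_mag_homology subspaces DirProd_group)
  have "?f \<in> hom ?A (?B \<times>\<times> ?C)"
  proof (rule homI)
    fix x assume "x \<in> carrier ?A"
    then obtain a where a: "a \<in> mag_cycles d ?W k" "x = mag_class d ?W k a"
      by (auto simp: carrier_mag_homology)
    show "?f x \<in> carrier (?B \<times>\<times> ?C)"
      unfolding a(2) f[OF a(1)] using WY[OF a(1)] by (simp add: hom_simps)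
    fix y assume "y \<in> carrier ?A"
    then obtain b where b: "b \<in> mag_cycles d ?W k" "y = mag_class d ?W k b"
      by (auto simp: carrier_mag_homology)
    have "?f (x \<otimes>\<^bsub>?A\<^esub> y) = ?f (mag_class d ?W k (a + b))"
      unfolding a(2) b(2) mult_mag_homology[OF subspaces(3) a(1) b(1)] ..
    also have "\<dots> = (mag_class d Y k (a + b), mag_class d Z k (- (a + b)))"
      by (rule f[OF mag_cycles_closed(2)[OF a(1) b(1)]])
    also have "\<dots> = ?f x \<otimes>\<^bsub>?B \<times>\<times> ?C\<^esub> ?f y"
      unfolding a(2) b(2) f[OF a(1)] f[OF b(1)] using WY[OF a(1)] WY[OF b(1)]
      by (simp add: hom_simps)
    finally show "?f (x \<otimes>\<^bsub>?A\<^esub> y) = ?f x \<otimes>\<^bsub>?B \<times>\<times> ?C\<^esub> ?f y" .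
  qed
  moreover have "?g \<in> hom (?B \<times>\<times> ?C) ?D"
  proof (rule homI)
    fix x assume "x \<in> carrier (?B \<times>\<times> ?C)"
    then obtain a b where x: "a \<in> mag_cycles d Y k" "b \<in> mag_cycles d Z k"
      "x = (mag_class d Y k a, mag_class d Z k b)"
      by (auto simp: carrier_mag_homology)
    show "?g x \<in> carrier ?D"
      unfolding x(3) g[OF x(1,2)] using YX x(1,2) by (simp add: hom_simps)
    fix y assume "y \<in> carrier (?B \<times>\<times> ?C)"
    then obtain a' b' where y: "a' \<in> mag_cycles d Y k" "b' \<in> mag_cycles d Z k"
      "y = (mag_class d Y k a', mag_class d Z k b')"
      by (auto simp: carrier_mag_homology)
    have "?g (x \<otimes>\<^bsub>?B \<times>\<times> ?C\<^esub> y) = ?g (mag_class d Y k (a + a'), mag_class d Z k (b + b'))"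
      unfolding x(3) y(3) mult_DirProd mult_mag_homology[OF subspaces(1) x(1) y(1)]
        mult_mag_homology[OF subspaces(2) x(2) y(2)] ..
    also have "\<dots> = mag_class d X k ((a + a') + (b + b'))"
      by (rule g[OF mag_cycles_closed(2)[OF x(1) y(1)] mag_cycles_closed(2)[OF x(2) y(2)]])
    also have "(a + a') + (b + b') = (a + b) + (a' + b')" by (simp add: algebra_simps)
    also have "mag_class d X k \<dots> = ?g x \<otimes>\<^bsub>?D\<^esub> ?g y"
      unfolding x(3) y(3) g[OF x(1,2)] g[OF y(1,2)] using YX x(1,2) y(1,2) by (simp add: hom_simps)
    finally show "?g (x \<otimes>\<^bsub>?B \<times>\<times> ?C\<^esub> y) = ?g x \<otimes>\<^bsub>?D\<^esub> ?g y" .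
  qed
  moreover have "inj_on ?f (carrier ?A)"
  proof (rule inj_onI)
    fix x y assume "x \<in> carrier ?A" "y \<in> carrier ?A" and eq: "?f x = ?f y"
    then obtain a b where a: "a \<in> mag_cycles d ?W k" "x = mag_class d ?W k a"
      and b: "b \<in> mag_cycles d ?W k" "y = mag_class d ?W k b"
      by (auto simp: carrier_mag_homology)
    have "mag_class d Z k (- a) = mag_class d Z k (- b)"
      using eq unfolding a(2) b(2) f[OF a(1)] f[OF b(1)] by blast
    then have "b - a \<in> mag_boundaries d Z k" by (simp add: mag_class_eq_iff)
    then have "b - a \<in> mag_boundaries d ?W k"
      by (rule boundary_in_gates[OF mag_cycles_closed(3)[OF b(1) a(1)]])
    then show "x = y" unfolding a(2) b(2) by (metis mag_class_eq_iff)
  qed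
  moreover have "?f ` carrier ?A = kernel (?B \<times>\<times> ?C) ?D ?g"
  proof (intro equalityI subsetI)
    fix x assume "x \<in> ?f ` carrier ?A"
    then obtain c where c: "c \<in> mag_cycles d ?W k" "x = ?f (mag_class d ?W k c)"
      unfolding carrier_mag_homology by blast
    have x: "x = (mag_class d Y k c, mag_class d Z k (- c))" using f c by simp
    show "x \<in> kernel (?B \<times>\<times> ?C) ?D ?g"
      unfolding kernel_def x using g[of c "- c"] WY[OF c(1)] by (simp add: hom_simps)
  next
    fix x assume x: "x \<in> kernel (?B \<times>\<times> ?C) ?D ?g"
    then obtain u v where uv: "u \<in> mag_cycles d Y k" "v \<in> mag_cycles d Z k"
      "x = (mag_class d Y k u, mag_class d Z k v)"
      by (auto simp: kernel_def carrier_mag_homology)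
    have "mag_class d X k (u + v) = mag_class d X k 0"
      using x unfolding uv(3) kernel_def one_mag_homology mem_Collect_eq g[OF uv(1,2)] by blast
    then have "u + v \<in> mag_boundaries d X k" by (simp add: mag_class_eq_iff)
    then obtain w where w: "w \<in> mag_cycles d ?W k" "u - w \<in> mag_boundaries d Y k"
      "v + w \<in> mag_boundaries d Z k"
      by (rule boundary_splits[OF uv(1,2)])
    have "x = ?f (mag_class d ?W k w)"
      unfolding uv(3) f[OF w(1)] using w(2,3) by (simp add: mag_class_eq_iff)
    then show "x \<in> ?f ` carrier ?A" using w(1) unfolding carrier_mag_homology by blast
  qed
  moreover have "?g ` carrier (?B \<times>\<times> ?C) = carrier ?D"
  proof
    show "?g ` carrier (?B \<times>\<times> ?C) \<subseteq> carrier ?D"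
      using \<open>?g \<in> hom (?B \<times>\<times> ?C) ?D\<close> unfolding hom_def by blast
    show "carrier ?D \<subseteq> ?g ` carrier (?B \<times>\<times> ?C)"
    proof
      fix x assume "x \<in> carrier ?D"
      then obtain c where c: "c \<in> mag_cycles d X k" "x = mag_class d X k c"
        by (auto simp: carrier_mag_homology)
      obtain u v where uv: "u \<in> mag_cycles d Y k" "v \<in> mag_cycles d Z k"
        "c - (u + v) \<in> mag_boundaries d X k"
        using c(1) by (rule cycle_splits)
      have "x = ?g (mag_class d Y k u, mag_class d Z k v)"
        unfolding c(2) g[OF uv(1,2)] using uv(3) by (simp add: mag_class_eq_iff)
      moreover have "(mag_class d Y k u, mag_class d Z k v) \<in> carrier (?B \<times>\<times> ?C)"
        using uv(1,2) by (simp add: carrier_mag_homology)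
      ultimately show "x \<in> ?g ` carrier (?B \<times>\<times> ?C)" by (rule image_eqI)
    qed
  qed
  ultimately show ?thesis
    unfolding short_exact_def group_hom_def group_hom_axioms_def using groups by blast
qed

end

text \<open>
  For a suitable \<open>w\<close> in \<open>W\<close> and the gate \<open>p\<close> of \<open>z\<close>, \<open>d y z = d y w + d w p + d p z\<close>. Replacing the first two
  terms by \<open>d y p\<close> does not increase the sum, which is at least \<open>d y z\<close> in any case.
\<close>

lemma gate_projection_exists:
  fixes d :: "'a \<Rightarrow> 'a \<Rightarrow> real"
  assumes "Metric_space X d" "gated_decomposition d X Y Z W"
    and glued: "\<forall>y\<in>Y. \<forall>z\<in>Z. \<exists>w\<in>W. metric_between d y w z"
  obtains \<pi> where "gate_projection X d Y Z \<pi>"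
proof -
  interpret Metric_space X d by fact
  have X: "X = Y \<union> Z" and W: "W = Y \<inter> Z" and gated: "gated_wrt d W Z"
    using assms(2) by (auto simp: gated_decomposition_def)
  from gated have "\<forall>z\<in>Z. \<exists>p. p \<in> W \<and> (\<forall>w\<in>W. d z w = d z p + d p w)"
    unfolding gated_wrt_def metric_between_def by blast
  then obtain \<pi> where "\<forall>z\<in>Z. \<pi> z \<in> W \<and> (\<forall>w\<in>W. d z w = d z (\<pi> z) + d (\<pi> z) w)"
    by (rule bchoice[THEN exE])
  then have \<pi>: "\<pi> z \<in> W" "\<And>w. w \<in> W \<Longrightarrow> d z w = d z (\<pi> z) + d (\<pi> z) w" if "z \<in> Z" for z
    using that by blast+
  have "gate_projection X d Y Z \<pi>"
  proof unfold_locales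
    show "X = Y \<union> Z" by fact
    show "\<pi> z \<in> Y \<inter> Z" if "z \<in> Z" for z using \<pi>(1)[OF that] W by simp
    show "d y z = d y (\<pi> z) + d (\<pi> z) z" if y: "y \<in> Y" and z: "z \<in> Z" for y z
    proof -
      obtain w where w: "w \<in> W" "d y z = d y w + d w z"
        using glued y z unfolding metric_between_def by blast
      have m: "y \<in> X" "z \<in> X" "w \<in> X" "\<pi> z \<in> X" using y z w \<pi>(1)[OF z] X W by auto
      have "d z w = d z (\<pi> z) + d (\<pi> z) w" using \<pi>(2)[OF z w(1)] .
      then show ?thesis
        using w(2) triangle[OF m(1,3,4)] triangle[OF m(1,4,2)] commute[of z w]
          commute[of "\<pi> z" w] commute[of z "\<pi> z"]
        by linarith
    qed
  qed
  then show thesis by (rule that)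
qed

theorem theorem3p14:
  fixes d :: "'a \<Rightarrow> 'a \<Rightarrow> real" and X Y Z W :: "'a set" and k :: nat
  assumes "Metric_space X d"
    and "gated_decomposition d X Y Z W"
    and glued: "\<forall>y\<in>Y. \<forall>z\<in>Z. \<exists>w\<in>W. metric_between d y w z"
  shows "short_exact
           (mag_homology d W k)
           (mag_homology d Y k \<times>\<times> mag_homology d Z k)
           (mag_homology d X k)
           (\<lambda>c. (mag_incl d k W Y c, inv\<^bsub>mag_homology d Z k\<^esub> (mag_incl d k W Z c)))
           (\<lambda>(u, v). mag_incl d k Y X u \<otimes>\<^bsub>mag_homology d X k\<^esub> mag_incl d k Z X v)"
proof -
  obtain \<pi> where "gate_projection X d Y Z \<pi>"
    using assms by (rule gate_projection_exists)
  then interpret gate_projection X d Y Z \<pi> .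
  have "W = Y \<inter> Z" using assms(2) by (simp add: gated_decomposition_def)
  then show ?thesis using mayer_vietoris_short_exact by simp
qed

end
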